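(* Let $u\in H^1(\Omega)$ be a solution of $\Delta u+k^2u=F_{\rho,D}$ in $\Omega$. Let $\omega\in S^2$ be regular with respect to $D$. Assume that $D$ has a circular cone singularity at $p(\omega)$ such that $D\cap B_\epsilon(p(\omega))=V_{p(\omega)}(-\mathbf n,\theta)\cap B_\epsilon(p(\omega))$ for some $\epsilon>0$, that $F_{\rho,D}$ is active at $p(\omega)$, and that $$\mathbf n\cdot\omega>\frac1{\sqrt3}.$$ Then the value $\gamma=\mathbf n\cdot\omega$ is the unique solution in $]\frac1{\sqrt3},1]$ of the quintic equation $$\gamma^3(3\gamma^2-1)=\frac{\left|\int_{S(\omega)}I(\omega,\vartheta)\,ds(\vartheta)\right|}{\pi\,\max_{\vartheta\in S(\omega)}|I(\omega,\vartheta)|}.$$ Besides, for an arbitrary $\vartheta\in S(\omega)$ the value $\mu=\mathbf n\cdot\vartheta$ is given by the formulae $$\mu^2=\frac{\gamma^3-\operatorname{Re}T(\omega,\vartheta)}{3\gamma}\qquad\text{and}\qquad \mu=\frac{\operatorname{Im}T(\omega,\vartheta)}{3\gamma^2-\mu^2},$$ where $$T(\omega,\vartheta)=\frac{\int_{S(\omega)}I(\omega,\vartheta')\,ds(\vartheta')}{\pi(3\gamma^2-1)\,I(\omega,\vartheta)}.$$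
   Context: Setting. $\Omega\subset\mathbb R^3$ is a bounded domain with $C^2$ boundary; $k\ge 0$. $D$ is a nonempty open set with $\overline D\subset\Omega$, $\rho\in L^2(D)$ is complex-valued, and $F_{\rho,D}$ equals $\rho$ on $D$ and $0$ on $\Omega\setminus D$. Solutions $u\in H^1(\Omega)$ are weak and complex-valued, with no boundary condition prescribed. $S(\omega)=\{\vartheta\in S^2:\omega\cdot\vartheta=0\}$, with arc length $ds$. $h_D(\omega)=\sup_{x\in D}x\cdot\omega$. $\omega$ is regular with respect to $D$ if $\{x\in\overline D: x\cdot\omega=h_D(\omega)\}$ is a single point, denoted $p(\omega)$. $B_\epsilon(p)$ is the open ball of radius $\epsilon$ centered at $p$. For $p\in\mathbb R^3$, $\mathbf n\in S^2$, $\theta\in\,]0,\frac\pi2[$: $V_p(-\mathbf n,\theta)=\{x\in\mathbb R^3:(x-p)\cdot(-\mathbf n)>|x-p|\cos\theta\}$. $D$ has a circular cone singularity at $p\in\partial D$ if $D\cap B_\epsilon(p)=V_p(-\mathbf n,\theta)\cap B_\epsilon(p)$ for some $\epsilon>0$, $\mathbf n\in S^2$, $\theta\in\,]0,\frac\pi2[$. $F_{\rho,D}$ is active at $p\in\partial D$ if there exist $\eta>0$, $0<\alpha\le1$ and a (complex-valued) $\tilde\rho\in C^{0,\alpha}(\overline{B_\eta(p)})$ such that $\rho=\tilde\rho$ almost everywhere on $B_\eta(p)\cap D$ and $\tilde\rho(p)\ne0$. For $\delta>0$ and a nonempty bounded relatively open subset $Q$ of the plane $x\cdot\omega=p\cdot\omega-\delta$,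 let $D_{(p,\omega)}(\delta,Q)=\bigcup_{0<s<\delta}\{p+\frac{s}{\delta}(z-p): z\in Q\}$ and, for $\vartheta\in S(\omega)$, $$C_{(p,\omega)}(\delta,Q,\vartheta)=2s\int_{Q_s}\frac{dS_z}{\{s-i(z-p)\cdot\vartheta\}^3},\qquad Q_s=D_{(p,\omega)}(\delta,Q)\cap\{x: x\cdot\omega=p\cdot\omega-s\},$$ which does not depend on $s\in\,]0,\delta[$. If $\omega$ is regular and $D$ has a circular cone singularity at $p(\omega)$, with $D\cap B_\epsilon(p(\omega))=V_{p(\omega)}(-\mathbf n,\theta)\cap B_\epsilon(p(\omega))$ for some $\epsilon>0$, $\mathbf n\in S^2$, $\theta\in\,]0,\frac\pi2[$, then $\mathbf n\cdot\omega>\sin\theta$ and, for all sufficiently small $\delta>0$, $D\cap\{x:h_D(\omega)-\delta<x\cdot\omega<h_D(\omega)\}=D_{(p(\omega),\omega)}(\delta,Q)$ with $Q=V_{p(\omega)}(-\mathbf n,\theta)\cap\{x:x\cdot\omega=h_D(\omega)-\delta\}$. With such $\delta,Q$ (the choice is immaterial) define $$I(\omega,\vartheta)=\tilde\rho(p(\omega))\,C_{(p(\omega),\omega)}(\delta,Q,\vartheta),\qquad\vartheta\in S(\omega).$$ *)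

theory Defs
  imports "HOL-Analysis.Analysis"
begin

section \<open>Domains with \<open>C\<^sup>2\<close> boundary and weak solutions\<close>

text \<open>Meant for open \<open>U\<close>: all partial derivatives up to the given order exist and are
  continuous on \<open>U\<close>.\<close>

fun Ck_on :: "nat \<Rightarrow> ('a::euclidean_space \<Rightarrow> 'b::real_normed_vector) \<Rightarrow> 'a set \<Rightarrow> bool" where
  "Ck_on 0 f U \<longleftrightarrow> continuous_on U f"
| "Ck_on (Suc m) f U \<longleftrightarrow>
     f differentiable_on U \<and> (\<forall>b\<in>Basis. Ck_on m (\<lambda>x. frechet_derivative f (at x) b) U)"

text \<open>Near each boundary point the set is, in suitable orthonormal coordinates, the part of
  a ball lying strictly above the graph of a \<open>C\<^sup>2\<close> function of two variables.\<close>

definition C2_boundary :: "(real^3) set \<Rightarrow> bool" where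
  "C2_boundary \<Omega> \<longleftrightarrow>
     (\<forall>x0\<in>frontier \<Omega>. \<exists>r>0. \<exists>a b c. \<exists>g :: real \<times> real \<Rightarrow> real.
        norm a = 1 \<and> norm b = 1 \<and> norm c = 1 \<and> a \<bullet> b = 0 \<and> a \<bullet> c = 0 \<and> b \<bullet> c = 0 \<and>
        Ck_on 2 g UNIV \<and>
        \<Omega> \<inter> ball x0 r = {x \<in> ball x0 r. x \<bullet> c > g (x \<bullet> a, x \<bullet> b)})"

definition L2_on :: "(real^3) set \<Rightarrow> (real^3 \<Rightarrow> complex) \<Rightarrow> bool" where
  "L2_on A f \<longleftrightarrow>
     set_borel_measurable lebesgue A f \<and> set_integrable lebesgue A (\<lambda>x. (norm (f x))\<^sup>2)"

definition test_function :: "(real^3) set \<Rightarrow> (real^3 \<Rightarrow> complex) \<Rightarrow> bool" where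
  "test_function \<Omega> \<phi> \<longleftrightarrow>
     (\<forall>m. Ck_on m \<phi> UNIV) \<and> compact (closure {x. \<phi> x \<noteq> 0}) \<and> closure {x. \<phi> x \<noteq> 0} \<subseteq> \<Omega>"

definition weak_partial ::
    "(real^3) set \<Rightarrow> real^3 \<Rightarrow> (real^3 \<Rightarrow> complex) \<Rightarrow> (real^3 \<Rightarrow> complex) \<Rightarrow> bool" where
  "weak_partial \<Omega> b u g \<longleftrightarrow>
     (\<forall>\<phi>. test_function \<Omega> \<phi> \<longrightarrow>
        (LINT x:\<Omega>|lebesgue. u x * frechet_derivative \<phi> (at x) b) =
        - (LINT x:\<Omega>|lebesgue. g x * \<phi> x))"

definition weak_gradient ::
    "(real^3) set \<Rightarrow> (real^3 \<Rightarrow> complex) \<Rightarrow> (real^3 \<Rightarrow> real^3 \<Rightarrow> complex) \<Rightarrow> bool" where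
  "weak_gradient \<Omega> u G \<longleftrightarrow> (\<forall>b\<in>Basis. L2_on \<Omega> (G b) \<and> weak_partial \<Omega> b u (G b))"

definition in_H1 :: "(real^3) set \<Rightarrow> (real^3 \<Rightarrow> complex) \<Rightarrow> bool" where
  "in_H1 \<Omega> u \<longleftrightarrow> L2_on \<Omega> u \<and> (\<exists>G. weak_gradient \<Omega> u G)"

text \<open>Weak form of \<open>\<Delta>u + k\<^sup>2u = F\<close>. Test functions vanish near the boundary, so no boundary
  condition is imposed.\<close>

definition H1_solution ::
    "(real^3) set \<Rightarrow> real \<Rightarrow> (real^3 \<Rightarrow> complex) \<Rightarrow> (real^3 \<Rightarrow> complex) \<Rightarrow> bool" where
  "H1_solution \<Omega> k F u \<longleftrightarrow> in_H1 \<Omega> u \<and>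
     (\<forall>G. weak_gradient \<Omega> u G \<longrightarrow> (\<forall>\<phi>. test_function \<Omega> \<phi> \<longrightarrow>
        - (\<Sum>b\<in>Basis. LINT x:\<Omega>|lebesgue. G b x * frechet_derivative \<phi> (at x) b)
        + of_real (k\<^sup>2) * (LINT x:\<Omega>|lebesgue. u x * \<phi> x)
        = (LINT x:\<Omega>|lebesgue. F x * \<phi> x)))"

definition source :: "(real^3 \<Rightarrow> complex) \<Rightarrow> (real^3) set \<Rightarrow> real^3 \<Rightarrow> complex" where
  "source \<rho> D = (\<lambda>x. if x \<in> D then \<rho> x else 0)"


section \<open>Support function, cone singularities, active sources\<close>

definition supp_fun :: "(real^3) set \<Rightarrow> real^3 \<Rightarrow> real" where
  "supp_fun D \<omega> = (SUP x\<in>D. x \<bullet> \<omega>)"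

definition support_set :: "(real^3) set \<Rightarrow> real^3 \<Rightarrow> (real^3) set" where
  "support_set D \<omega> = {x \<in> closure D. x \<bullet> \<omega> = supp_fun D \<omega>}"

definition regular_dir :: "(real^3) set \<Rightarrow> real^3 \<Rightarrow> bool" where
  "regular_dir D \<omega> \<longleftrightarrow> is_singleton (support_set D \<omega>)"

definition support_point :: "(real^3) set \<Rightarrow> real^3 \<Rightarrow> real^3" where
  "support_point D \<omega> = the_elem (support_set D \<omega>)"

definition circ_cone :: "real^3 \<Rightarrow> real^3 \<Rightarrow> real \<Rightarrow> (real^3) set" where
  "circ_cone p m \<theta> = {x. (x - p) \<bullet> m > norm (x - p) * cos \<theta>}"

definition cone_singularity :: "(real^3) set \<Rightarrow> real^3 \<Rightarrow> real^3 \<Rightarrow> real \<Rightarrow> bool" where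
  "cone_singularity D p n \<theta> \<longleftrightarrow>
     p \<in> frontier D \<and> norm n = 1 \<and> 0 < \<theta> \<and> \<theta> < pi / 2 \<and>
     (\<exists>\<epsilon>>0. D \<inter> ball p \<epsilon> = circ_cone p (- n) \<theta> \<inter> ball p \<epsilon>)"

definition holder_on :: "real \<Rightarrow> (real^3) set \<Rightarrow> (real^3 \<Rightarrow> complex) \<Rightarrow> bool" where
  "holder_on \<alpha> A f \<longleftrightarrow> (\<exists>C. \<forall>x\<in>A. \<forall>y\<in>A. norm (f x - f y) \<le> C * norm (x - y) powr \<alpha>)"

text \<open>The source is active at \<open>p\<close>, with \<open>\<rho>'\<close> a Hoelder continuous representative of \<open>\<rho>\<close>
  near \<open>p\<close>.\<close>

definition active_with ::
    "(real^3 \<Rightarrow> complex) \<Rightarrow> (real^3) set \<Rightarrow> real^3 \<Rightarrow> (real^3 \<Rightarrow> complex) \<Rightarrow> bool" where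
  "active_with \<rho> D p \<rho>' \<longleftrightarrow> p \<in> frontier D \<and>
     (\<exists>\<eta>>0. \<exists>\<alpha>. 0 < \<alpha> \<and> \<alpha> \<le> 1 \<and> holder_on \<alpha> (cball p \<eta>) \<rho>' \<and>
        (AE x in lebesgue. x \<in> ball p \<eta> \<inter> D \<longrightarrow> \<rho> x = \<rho>' x)) \<and>
     \<rho>' p \<noteq> 0"


section \<open>Arc length on great circles and area on planes\<close>

definition great_circle :: "real^3 \<Rightarrow> (real^3) set" where
  "great_circle \<omega> = {\<xi>. norm \<xi> = 1 \<and> \<omega> \<bullet> \<xi> = 0}"

text \<open>An orthonormal basis of the plane orthogonal to \<open>\<omega>\<close>. The two measures below are
  independent of the choice, by rotation and reflection invariance.\<close>

definition perp_frame :: "real^3 \<Rightarrow> (real^3) \<times> (real^3)" where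
  "perp_frame \<omega> = (SOME (a, b). norm a = 1 \<and> norm b = 1 \<and> a \<bullet> b = 0 \<and> a \<bullet> \<omega> = 0 \<and> b \<bullet> \<omega> = 0)"

text \<open>Arc length on \<open>great_circle \<omega>\<close>, as a Borel measure on the whole space.\<close>

definition arc_length :: "real^3 \<Rightarrow> (real^3) measure" where
  "arc_length \<omega> = (case perp_frame \<omega> of (a, b) \<Rightarrow>
     distr (restrict_space lborel {0..<2 * pi}) borel (\<lambda>t. cos t *\<^sub>R a + sin t *\<^sub>R b))"

text \<open>Surface area on the plane \<open>{x. x \<bullet> \<omega> = c}\<close> (for a unit vector \<open>\<omega>\<close>), as a Borel
  measure on the whole space.\<close>

definition plane_area :: "real^3 \<Rightarrow> real \<Rightarrow> (real^3) measure" where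
  "plane_area \<omega> c = (case perp_frame \<omega> of (a, b) \<Rightarrow>
     distr (lborel :: (real \<times> real) measure) borel
       (\<lambda>(x, y). c *\<^sub>R \<omega> + x *\<^sub>R a + y *\<^sub>R b))"


section \<open>The constant \<open>C\<close> and the indicator function \<open>I\<close>\<close>

definition cone_over :: "real^3 \<Rightarrow> real \<Rightarrow> (real^3) set \<Rightarrow> (real^3) set" where
  "cone_over p \<delta> Q = (\<Union>s\<in>{0<..<\<delta>}. (\<lambda>z. p + (s / \<delta>) *\<^sub>R (z - p)) ` Q)"

definition cone_slice :: "real^3 \<Rightarrow> real^3 \<Rightarrow> real \<Rightarrow> (real^3) set \<Rightarrow> real \<Rightarrow> (real^3) set" where
  "cone_slice p \<omega> \<delta> Q s = cone_over p \<delta> Q \<inter> {x. x \<bullet> \<omega> = p \<bullet> \<omega> - s}"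

text \<open>The common value over all \<open>s\<close> strictly between \<open>0\<close> and \<open>\<delta>\<close>.\<close>

definition cone_const :: "real^3 \<Rightarrow> real^3 \<Rightarrow> real \<Rightarrow> (real^3) set \<Rightarrow> real^3 \<Rightarrow> complex" where
  "cone_const p \<omega> \<delta> Q \<xi> =
     (THE c. \<forall>s\<in>{0<..<\<delta>}. c = 2 * of_real s *
        (LINT z:cone_slice p \<omega> \<delta> Q s|plane_area \<omega> (p \<bullet> \<omega> - s).
           1 / (of_real s - \<i> * of_real ((z - p) \<bullet> \<xi>)) ^ 3))"

definition cone_base :: "(real^3) set \<Rightarrow> real^3 \<Rightarrow> real^3 \<Rightarrow> real \<Rightarrow> real \<Rightarrow> (real^3) set" where
  "cone_base D \<omega> n \<theta> \<delta> =
     circ_cone (support_point D \<omega>) (- n) \<theta> \<inter> {x. x \<bullet> \<omega> = supp_fun D \<omega> - \<delta>}"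

definition admissible :: "(real^3) set \<Rightarrow> real^3 \<Rightarrow> real^3 \<Rightarrow> real \<Rightarrow> real \<Rightarrow> bool" where
  "admissible D \<omega> n \<theta> \<delta> \<longleftrightarrow> \<delta> > 0 \<and>
     D \<inter> {x. supp_fun D \<omega> - \<delta> < x \<bullet> \<omega> \<and> x \<bullet> \<omega> < supp_fun D \<omega>} =
       cone_over (support_point D \<omega>) \<delta> (cone_base D \<omega> n \<theta> \<delta>)"

text \<open>The common value over all admissible \<open>\<delta>\<close>. If no \<open>\<delta>\<close> were admissible, every complex number
  would satisfy the description, so the value would be unspecified.\<close>

definition indicator_I ::
    "(real^3) set \<Rightarrow> (real^3 \<Rightarrow> complex) \<Rightarrow> real^3 \<Rightarrow> real \<Rightarrow> real^3 \<Rightarrow> real^3 \<Rightarrow> complex" where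
  "indicator_I D \<rho>' n \<theta> \<omega> \<xi> =
     (THE c. \<forall>\<delta>. admissible D \<omega> n \<theta> \<delta> \<longrightarrow>
        c = \<rho>' (support_point D \<omega>) *
            cone_const (support_point D \<omega>) \<omega> \<delta> (cone_base D \<omega> n \<theta> \<delta>) \<xi>)"

end

theory Submission
  imports Defs
begin

text \<open>The reconstruction formulae rest on one closed form. Write \<open>\<gamma> = n \<bullet> \<omega>\<close> and, for a direction \<open>\<xi>\<close> of the great
circle, \<open>\<mu> = n \<bullet> \<xi>\<close>. Then the constant of the circular cone with axis \<open>- n\<close> and half-angle \<open>\<theta>\<close> is
\<open>C(\<xi>) = 2 \<pi> cos \<theta> sin\<^sup>2 \<theta> / (\<gamma> + \<i> \<mu>)\<^sup>3\<close> (\<open>cone_const_circ_cone\<close>), so that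
\<open>I(\<xi>) = K / (\<gamma> + \<i> \<mu>)\<^sup>3\<close> with a nonzero \<open>K\<close> that does not depend on \<open>\<xi>\<close>. Everything asked for
can be read off from this:

\<^item> \<open>\<bar>I(\<xi>)\<bar> = \<bar>K\<bar> / \<bar>\<gamma> + \<i> \<mu>\<bar>\<^sup>3\<close> is largest where \<open>\<mu> = 0\<close>, with value \<open>\<bar>K\<bar> / \<gamma>\<^sup>3\<close>;
\<^item> since \<open>n\<close> is a unit vector, \<open>\<mu>\<close> runs through \<open>\<sigma> cos t\<close> with \<open>\<sigma>\<^sup>2 = 1 - \<gamma>\<^sup>2\<close>, and
  \<open>\<integral> dt / (\<gamma> + \<i> \<sigma> cos t)\<^sup>3 = \<pi> (3 \<gamma>\<^sup>2 - 1)\<close> over a period (\<open>great_circle_cube_integral\<close>);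
\<^item> hence the right-hand side of the quintic is \<open>\<gamma>\<^sup>3 (3 \<gamma>\<^sup>2 - 1)\<close>, and the quintic polynomial is
  strictly increasing beyond \<open>1 / \<surd>3\<close>, so \<open>\<gamma>\<close> is its only solution there;
\<^item> hence also \<open>T(\<xi>) = (\<gamma> + \<i> \<mu>)\<^sup>3\<close>, whose real part \<open>\<gamma>\<^sup>3 - 3 \<gamma> \<mu>\<^sup>2\<close> and imaginary part
  \<open>\<mu> (3 \<gamma>\<^sup>2 - \<mu>\<^sup>2)\<close> give the two formulae for \<open>\<mu>\<close>.

To obtain the closed form, the plane section of the cone is described in an orthonormal frame whose first
vector is \<open>\<xi>\<close>. The integrand then depends on the first coordinate \<open>x\<close> only, and the section is an
ellipse; the length of its chord over \<open>x\<close> is a multiple of \<open>\<surd>(r\<^sup>2 - (x - x\<^sub>0)\<^sup>2)\<close>. Putting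
\<open>x = x\<^sub>0 + r cos t\<close> turns the area integral into one of the form \<open>\<integral> sin\<^sup>2 t / (w + b cos t)\<^sup>3 dt\<close>.
Both trigonometric integrals have explicit antiderivatives in terms of that of \<open>1 / (w + b cos t)\<close>.

That the section is an ellipse requires \<open>\<gamma> > sin \<theta>\<close>. This is where regularity of \<open>\<omega>\<close> enters
(\<open>regular_cone_is_steep\<close>): the closed cone meets the supporting plane at its apex only. The same
inequality makes thin slabs of the cone small, so that slabs of \<open>D\<close> below the supporting plane
are slabs of the cone (\<open>admissible_exists\<close>) and the indicator function is well defined.\<close>

section \<open>Integrals of powers of a linear trigonometric polynomial\<close>

lemma norm_diff_less_norm_add:
  fixes w q :: complex
  assumes "Re (q * cnj w) > 0"
  shows "norm (w - q) < norm (w + q)"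
proof -
  have "(norm (w - q))\<^sup>2 < (norm (w + q))\<^sup>2"
    unfolding cmod_power2 using assms by (simp add: power2_eq_square algebra_simps)
  then show ?thesis
    by (rule power2_less_imp_less) simp
qed

text \<open>The product of \<open>1 - \<zeta> exp (\<i> t)\<close> and \<open>1 - \<zeta> exp (- \<i> t)\<close> equals \<open>1 + \<zeta>\<^sup>2 - 2 \<zeta> cos t\<close>, which matches
\<open>w + b cos t\<close> up to a factor when \<open>\<zeta>\<close> is a root of \<open>b \<zeta>\<^sup>2 + 2 w \<zeta> + b = 0\<close>. The two roots have
product 1; the sign condition on \<open>q = \<surd>(w\<^sup>2 - b\<^sup>2)\<close> selects the one inside the unit disc.\<close>

lemma trig_linear_factorization:
  fixes w b q :: complex
  assumes q: "q\<^sup>2 = w\<^sup>2 - b\<^sup>2" and pos: "Re (q * cnj w) > 0"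
  obtains \<zeta> where "norm \<zeta> < 1" and "q = (w + q) / 2 * (1 - \<zeta>\<^sup>2)"
    and "\<And>t. w + b * cos t = (w + q) / 2 * ((1 - \<zeta> * exp (\<i> * t)) * (1 - \<zeta> * exp (- (\<i> * t))))"
proof
  define \<zeta> where "\<zeta> = - b / (w + q)"
  have lt: "norm (w - q) < norm (w + q)"
    by (rule norm_diff_less_norm_add[OF pos])
  then have nz: "w + q \<noteq> 0" by auto
  have b2: "b\<^sup>2 = (w - q) * (w + q)"
    using q by (simp add: power2_eq_square algebra_simps)
  then have "(norm b)\<^sup>2 = norm ((w - q) * (w + q))"
    by (simp add: norm_power[symmetric])
  also have "\<dots> < norm (w + q) * norm (w + q)"
    unfolding norm_mult using lt nz by (intro mult_strict_right_mono) auto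
  finally have "(norm b)\<^sup>2 < (norm (w + q))\<^sup>2" by (simp add: power2_eq_square)
  then have "norm b < norm (w + q)" by (rule power2_less_imp_less) simp
  then show "norm \<zeta> < 1" using nz by (simp add: \<zeta>_def norm_divide)
  have z2: "\<zeta>\<^sup>2 = (w - q) / (w + q)"
    unfolding \<zeta>_def power_divide power2_minus b2 using nz by (simp add: power2_eq_square)
  show "q = (w + q) / 2 * (1 - \<zeta>\<^sup>2)"
  proof -
    have "1 - \<zeta>\<^sup>2 = 2 * q / (w + q)"
      unfolding z2 using nz by (simp add: diff_divide_eq_iff)
    then show ?thesis using nz by simp
  qed
  fix t
  have e: "exp (\<i> * t) * exp (- (\<i> * t)) = 1"
    by (simp add: exp_add[symmetric])
  have c: "exp (\<i> * t) + exp (- (\<i> * t)) = 2 * cos t"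
    by (simp add: cos_exp_eq)
  have "(1 - \<zeta> * exp (\<i> * t)) * (1 - \<zeta> * exp (- (\<i> * t)))
      = 1 + \<zeta>\<^sup>2 * (exp (\<i> * t) * exp (- (\<i> * t))) - \<zeta> * (exp (\<i> * t) + exp (- (\<i> * t)))"
    by (simp add: algebra_simps power2_eq_square)
  also have "\<dots> = 1 + \<zeta>\<^sup>2 - 2 * \<zeta> * cos t" by (simp only: e c) simp
  also have "(w + q) / 2 * \<dots> = w + b * cos t"
  proof -
    have "1 + \<zeta>\<^sup>2 = 2 * w / (w + q)"
      unfolding z2 using nz by (simp add: add_divide_eq_iff)
    then have e: "1 + \<zeta>\<^sup>2 - 2 * \<zeta> * cos t = 2 * (w + b * cos t) / (w + q)"
      by (simp add: \<zeta>_def add_divide_distrib ring_distribs)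
    have "(w + q) / 2 * (2 * y / (w + q)) = y" for y
      using nz by simp
    then show ?thesis unfolding e .
  qed
  finally show "w + b * cos t = (w + q) / 2 * ((1 - \<zeta> * exp (\<i> * t)) * (1 - \<zeta> * exp (- (\<i> * t))))" ..
qed

text \<open>The factorization gives \<open>q / (w + b cos t) = 1 + z / (1 - z) + z' / (1 - z')\<close> with \<open>z\<close> and \<open>z'\<close> the
two exponential terms, a Poisson kernel with complex parameter. Its antiderivative is \<open>t\<close> plus
two logarithms, which are \<open>2 \<pi>\<close>-periodic and cancel at \<open>0\<close> and \<open>\<pi>\<close>; as \<open>\<bar>z\<bar> < 1\<close>, the principal branch
applies throughout.\<close>

lemma trig_linear_reciprocal_antiderivative:
  fixes w b q :: complex
  assumes q: "q\<^sup>2 = w\<^sup>2 - b\<^sup>2" and pos: "Re (q * cnj w) > 0"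
  obtains G :: "complex \<Rightarrow> complex"
  where "\<And>t::real. (G has_field_derivative 1 / (w + b * cos (of_real t))) (at (of_real t))"
    and "\<And>t::real. w + b * cos (of_real t) \<noteq> 0"
    and "\<And>t. G (t + 2 * of_real pi) = G t + 2 * of_real pi / q"
    and "G (of_real pi) - G 0 = of_real pi / q"
proof -
  obtain \<zeta> where z: "norm \<zeta> < 1" and qz: "q = (w + q) / 2 * (1 - \<zeta>\<^sup>2)"
    and D: "\<And>t. w + b * cos t = (w + q) / 2 * ((1 - \<zeta> * exp (\<i> * t)) * (1 - \<zeta> * exp (- (\<i> * t))))"
    by (rule trig_linear_factorization[OF q pos]) (rule that)
  have nz: "w + q \<noteq> 0" "q \<noteq> 0"
    using norm_diff_less_norm_add[OF pos] pos by auto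
  define Z where "Z = (\<lambda>t. \<zeta> * exp (\<i> * t))"
  define Z' where "Z' = (\<lambda>t. \<zeta> * exp (- (\<i> * t)))"
  define G where "G = (\<lambda>t. (t + \<i> * Ln (1 - Z t) - \<i> * Ln (1 - Z' t)) / q)"
  have right: "1 - x \<notin> \<real>\<^sub>\<le>\<^sub>0" if "norm x < 1" for x :: complex
  proof
    assume "1 - x \<in> \<real>\<^sub>\<le>\<^sub>0"
    then have "Re x \<ge> 1" by (auto simp: complex_nonpos_Reals_iff)
    with that show False using complex_Re_le_cmod[of x] by linarith
  qed
  have lt: "norm (Z (of_real t)) < 1" "norm (Z' (of_real t)) < 1" for t :: real
    using z by (simp_all add: Z_def Z'_def norm_mult)
  have ne: "1 - Z (of_real t) \<noteq> 0" "1 - Z' (of_real t) \<noteq> 0" for t :: real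
    using lt[of t] by auto
  have ZZ: "Z t * Z' t = \<zeta>\<^sup>2" for t
    by (simp add: Z_def Z'_def power2_eq_square exp_minus)
  have DZ: "w + b * cos t = (w + q) / 2 * ((1 - Z t) * (1 - Z' t))" for t
    unfolding Z_def Z'_def by (rule D)
  show thesis
  proof
    fix t :: real
    let ?t = "of_real t :: complex"
    show "w + b * cos ?t \<noteq> 0"
      unfolding DZ using ne nz by simp
    have dZ: "(Z has_field_derivative \<i> * Z ?t) (at ?t)"
      unfolding Z_def by (auto intro!: derivative_eq_intros)
    have dZ': "(Z' has_field_derivative - \<i> * Z' ?t) (at ?t)"
      unfolding Z'_def by (auto intro!: derivative_eq_intros)
    have dLn: "((\<lambda>t. Ln (1 - h t)) has_field_derivative inverse (1 - h ?t) * (0 - h')) (at ?t)"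
      if "norm (h ?t) < 1" "(h has_field_derivative h') (at ?t)" for h h'
      by (rule DERIV_chain2[where f = Ln and g = "\<lambda>t. 1 - h t",
            OF has_field_derivative_Ln[OF right[OF that(1)]]])
         (intro DERIV_diff DERIV_const that)
    have "(G has_field_derivative
        (1 + \<i> * (inverse (1 - Z ?t) * (0 - \<i> * Z ?t))
           - \<i> * (inverse (1 - Z' ?t) * (0 - - \<i> * Z' ?t))) / q) (at ?t)"
      unfolding G_def
      by (intro DERIV_cdivide DERIV_add DERIV_diff DERIV_cmult DERIV_ident dLn dZ dZ' lt)
    also have "(1 + \<i> * (inverse (1 - Z ?t) * (0 - \<i> * Z ?t))
           - \<i> * (inverse (1 - Z' ?t) * (0 - - \<i> * Z' ?t))) / q
        = (1 + Z ?t / (1 - Z ?t) + Z' ?t / (1 - Z' ?t)) / q"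
      by (simp add: field_simps)
    also have "\<dots> = (1 - Z ?t * Z' ?t) / ((1 - Z ?t) * (1 - Z' ?t)) / q"
      using ne[of t] by (simp add: divide_simps) (simp add: algebra_simps)
    also have "\<dots> = 1 / (w + b * cos ?t)"
    proof -
      have "1 - \<zeta>\<^sup>2 \<noteq> 0" using qz nz by auto
      have q2: "q * 2 = (w + q) * (1 - \<zeta>\<^sup>2)" using qz by (simp add: field_simps)
      show ?thesis
        unfolding DZ ZZ using ne[of t] nz
        by (simp add: divide_simps) (simp add: q2[symmetric] mult_ac)
    qed
    finally show "(G has_field_derivative 1 / (w + b * cos ?t)) (at ?t)" .
  next
    fix t :: complex
    have "Z (t + 2 * of_real pi) = Z t" "Z' (t + 2 * of_real pi) = Z' t"
      by (simp_all add: Z_def Z'_def ring_distribs exp_add exp_diff mult_ac exp_two_pi_i' exp_minus)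
    then show "G (t + 2 * of_real pi) = G t + 2 * of_real pi / q"
      by (simp add: G_def add_divide_distrib diff_divide_distrib)
  next
    show "G (of_real pi) - G 0 = of_real pi / q"
      by (simp add: G_def Z_def Z'_def exp_minus)
  qed
qed

text \<open>Write \<open>D = w + b cos t\<close>. The derivatives of \<open>b sin t / D\<close> and \<open>b sin t / D\<^sup>2\<close> are linear combinations of powers of
\<open>1 / D\<close>, so they reduce \<open>1 / D\<^sup>3\<close> to a multiple of \<open>1 / D\<close> up to the derivative of a periodic function.
The phase \<open>\<phi>\<close> is harmless for the same reason: only the increment over a full period matters.\<close>

lemma trig_linear_cube_integral:
  fixes w b q :: complex and \<phi> :: real
  assumes q: "q\<^sup>2 = w\<^sup>2 - b\<^sup>2" and pos: "Re (q * cnj w) > 0"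
  shows "((\<lambda>t. 1 / (w + b * of_real (cos (t - \<phi>))) ^ 3) has_integral
           of_real pi * (3 * w\<^sup>2 - q\<^sup>2) / q ^ 5) {0..2 * pi}"
proof -
  obtain G :: "complex \<Rightarrow> complex"
    where G: "\<And>t::real. (G has_field_derivative 1 / (w + b * cos (of_real t))) (at (of_real t))"
      and ne: "\<And>t::real. w + b * cos (of_real t) \<noteq> 0"
      and per: "\<And>t. G (t + 2 * of_real pi) = G t + 2 * of_real pi / q"
    using trig_linear_reciprocal_antiderivative[OF q pos] by metis
  have qnz: "q \<noteq> 0" using pos by auto
  define D where "D = (\<lambda>t. w + b * cos t)"
  define F where "F = (\<lambda>t. (3 * w\<^sup>2 - q\<^sup>2) / (2 * q ^ 4) * G t
      - b * (sin t / (D t)\<^sup>2 / (2 * q\<^sup>2) + 3 * w / (2 * q ^ 4) * (sin t / D t)))"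
  have F: "(F has_field_derivative 1 / D (of_real t) ^ 3) (at (of_real t))" for t :: real
  proof -
    let ?t = "of_real t :: complex"
    have D0: "D ?t \<noteq> 0" using ne by (simp add: D_def)
    have dG: "(G has_field_derivative 1 / D ?t) (at ?t)" using G by (simp add: D_def)
    have dD: "(D has_field_derivative - (b * sin ?t)) (at ?t)"
      unfolding D_def by (auto intro!: derivative_eq_intros)
    \<comment> \<open>Expressing everything through \<open>D\<close> leaves identities between rational functions of \<open>D\<close>.\<close>
    have bc: "b * cos ?t = D ?t - w" by (simp add: D_def)
    have "(b * sin ?t)\<^sup>2 = b\<^sup>2 - (b * cos ?t)\<^sup>2"
      by (simp add: power_mult_distrib sin_squared_eq algebra_simps)
    then have bs: "b\<^sup>2 * (sin ?t)\<^sup>2 = w\<^sup>2 - q\<^sup>2 - (D ?t - w)\<^sup>2"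
      using q by (simp add: bc power_mult_distrib)
    have "((\<lambda>t. b * (sin t / D t)) has_field_derivative
         b * ((cos ?t * D ?t + b * sin ?t * sin ?t) / (D ?t)\<^sup>2)) (at ?t)"
      using D0 by (auto intro!: derivative_eq_intros dD simp: field_simps power2_eq_square)
    also have "b * ((cos ?t * D ?t + b * sin ?t * sin ?t) / (D ?t)\<^sup>2)
        = ((b * cos ?t) * D ?t + b\<^sup>2 * (sin ?t)\<^sup>2) / (D ?t)\<^sup>2"
      by (simp add: algebra_simps power2_eq_square)
    also have "\<dots> = w / D ?t - q\<^sup>2 / (D ?t)\<^sup>2"
      unfolding bc bs using D0 by (simp add: divide_simps) (simp add: algebra_simps power2_eq_square)
    finally have d1: "((\<lambda>t. b * (sin t / D t)) has_field_derivative w / D ?t - q\<^sup>2 / (D ?t)\<^sup>2) (at ?t)" .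
    have "((\<lambda>t. b * (sin t / (D t)\<^sup>2)) has_field_derivative
         b * ((cos ?t * D ?t + 2 * b * sin ?t * sin ?t) / (D ?t) ^ 3)) (at ?t)"
      using D0 by (auto intro!: derivative_eq_intros dD simp: field_simps power2_eq_square power3_eq_cube)
    also have "b * ((cos ?t * D ?t + 2 * b * sin ?t * sin ?t) / (D ?t) ^ 3)
        = ((b * cos ?t) * D ?t + 2 * (b\<^sup>2 * (sin ?t)\<^sup>2)) / (D ?t) ^ 3"
      by (simp add: algebra_simps power2_eq_square)
    also have "\<dots> = - (1 / D ?t) + 3 * w / (D ?t)\<^sup>2 - 2 * q\<^sup>2 / (D ?t) ^ 3"
      unfolding bc bs using D0
      by (simp add: divide_simps) (simp add: algebra_simps power2_eq_square power3_eq_cube)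
    finally have d2: "((\<lambda>t. b * (sin t / (D t)\<^sup>2)) has_field_derivative
        - (1 / D ?t) + 3 * w / (D ?t)\<^sup>2 - 2 * q\<^sup>2 / (D ?t) ^ 3) (at ?t)" .
    have Feq: "F = (\<lambda>t. (3 * w\<^sup>2 - q\<^sup>2) / (2 * q ^ 4) * G t
        - (1 / (2 * q\<^sup>2)) * (b * (sin t / (D t)\<^sup>2)) - (3 * w / (2 * q ^ 4)) * (b * (sin t / D t)))"
      by (rule ext) (simp add: F_def algebra_simps)
    have "(F has_field_derivative (3 * w\<^sup>2 - q\<^sup>2) / (2 * q ^ 4) * (1 / D ?t)
        - (1 / (2 * q\<^sup>2)) * (- (1 / D ?t) + 3 * w / (D ?t)\<^sup>2 - 2 * q\<^sup>2 / (D ?t) ^ 3)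
        - (3 * w / (2 * q ^ 4)) * (w / D ?t - q\<^sup>2 / (D ?t)\<^sup>2)) (at ?t)"
      unfolding Feq
      by (intro DERIV_diff DERIV_cmult d1 d2 dG)
    also have "(3 * w\<^sup>2 - q\<^sup>2) / (2 * q ^ 4) * (1 / D ?t)
        - (1 / (2 * q\<^sup>2)) * (- (1 / D ?t) + 3 * w / (D ?t)\<^sup>2 - 2 * q\<^sup>2 / (D ?t) ^ 3)
        - (3 * w / (2 * q ^ 4)) * (w / D ?t - q\<^sup>2 / (D ?t)\<^sup>2) = 1 / D ?t ^ 3"
      using D0 qnz by (simp add: divide_simps) (simp add: algebra_simps power2_eq_square eval_nat_numeral)
    finally show ?thesis .
  qed
  have "((\<lambda>t. F (of_real (t - \<phi>))) has_vector_derivative 1 / D (of_real (t - \<phi>)) ^ 3) (at t within S)"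
    for t S
  proof -
    have "((F \<circ> (\<lambda>z. z - of_real \<phi>)) has_field_derivative 1 / D (of_real (t - \<phi>)) ^ 3 * 1) (at (of_real t))"
      by (rule DERIV_chain) (use F[of "t - \<phi>"] in \<open>auto intro!: derivative_eq_intros\<close>)
    from has_vector_derivative_real_field[OF this] show ?thesis by (simp add: o_def)
  qed
  then have "((\<lambda>t. 1 / D (of_real (t - \<phi>)) ^ 3) has_integral
      F (of_real (2 * pi - \<phi>)) - F (of_real (0 - \<phi>))) {0..2 * pi}"
    by (intro fundamental_theorem_of_calculus) auto
  moreover have "F (of_real (2 * pi - \<phi>)) - F (of_real (0 - \<phi>)) = of_real pi * (3 * w\<^sup>2 - q\<^sup>2) / q ^ 5"
  proof -
    have a: "of_real (2 * pi - \<phi>) = (of_real (0 - \<phi>) + 2 * of_real pi :: complex)" by simp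
    have "sin (2 * of_real pi) = (0 :: complex)" "cos (2 * of_real pi) = (1 :: complex)"
      using sin_of_real[of "2 * pi", where 'a = complex] cos_of_real[of "2 * pi", where 'a = complex]
      by simp_all
    then have "D (t + 2 * of_real pi) = D t" "sin (t + 2 * of_real pi) = sin t" for t :: complex
      by (simp_all add: D_def sin_add cos_add)
    then have perF: "F (t + 2 * of_real pi) - F t = (3 * w\<^sup>2 - q\<^sup>2) / (2 * q ^ 4) * (2 * of_real pi / q)" for t
      unfolding F_def by (simp only: per distrib_left) simp
    show ?thesis
      unfolding a perF using qnz by (simp add: eval_nat_numeral field_simps)
  qed
  ultimately show ?thesis by (simp add: D_def cos_of_real[symmetric])
qed

text \<open>With \<open>D = w + b cos t\<close>, the function \<open>sin\<^sup>2 t / D\<^sup>3 - 1 / (2 q\<^sup>2 D)\<close> is the derivative of a multiple of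
\<open>sin t (b + w cos t) / D\<^sup>2\<close>, which vanishes at both ends of \<open>[0, \<pi>]\<close>. In this form no
division by \<open>b\<close> occurs, so that \<open>b = 0\<close> is no special case.\<close>

lemma trig_linear_sin_antiderivative:
  fixes w b q :: complex
  assumes q: "q\<^sup>2 = w\<^sup>2 - b\<^sup>2" and pos: "Re (q * cnj w) > 0"
  obtains F :: "real \<Rightarrow> complex"
  where "\<And>t. (F has_vector_derivative of_real ((sin t)\<^sup>2) / (w + b * of_real (cos t)) ^ 3) (at t)"
    and "F pi - F 0 = of_real pi / (2 * q ^ 3)"
proof -
  obtain G :: "complex \<Rightarrow> complex"
    where G: "\<And>t::real. (G has_field_derivative 1 / (w + b * cos (of_real t))) (at (of_real t))"
      and ne: "\<And>t::real. w + b * cos (of_real t) \<noteq> 0"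
      and half: "G (of_real pi) - G 0 = of_real pi / q"
    using trig_linear_reciprocal_antiderivative[OF q pos] by metis
  have qnz: "q \<noteq> 0" using pos by auto
  define D where "D = (\<lambda>t. w + b * cos t)"
  define F where "F = (\<lambda>t. (G t - sin t * (b + w * cos t) / (D t)\<^sup>2) / (2 * q\<^sup>2))"
  have F: "(F has_field_derivative (sin (of_real t))\<^sup>2 / D (of_real t) ^ 3) (at (of_real t))" for t :: real
  proof -
    let ?t = "of_real t :: complex"
    have D0: "D ?t \<noteq> 0" using ne by (simp add: D_def)
    have dG: "(G has_field_derivative 1 / D ?t) (at ?t)" using G by (simp add: D_def)
    have dD: "(D has_field_derivative - (b * sin ?t)) (at ?t)"
      unfolding D_def by (auto intro!: derivative_eq_intros)
    let ?N = "((cos ?t * (b + w * cos ?t) - w * (sin ?t)\<^sup>2) * D ?t + 2 * b * (sin ?t)\<^sup>2 * (b + w * cos ?t))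
          / (D ?t) ^ 3"
    have d: "((\<lambda>t. sin t * (b + w * cos t) / (D t)\<^sup>2) has_field_derivative ?N) (at ?t)"
      using D0 by (auto intro!: derivative_eq_intros dD simp: divide_simps)
        (simp add: algebra_simps power2_eq_square eval_nat_numeral)
    have "(F has_field_derivative (1 / D ?t - ?N) / (2 * q\<^sup>2)) (at ?t)"
      unfolding F_def by (intro DERIV_cdivide DERIV_diff d dG)
    also have "1 / D ?t - ?N = ((D ?t)\<^sup>2 - ((cos ?t * (b + w * cos ?t) - w * (sin ?t)\<^sup>2) * D ?t
        + 2 * b * (sin ?t)\<^sup>2 * (b + w * cos ?t))) / D ?t ^ 3"
      using D0 by (simp add: field_simps power2_eq_square power3_eq_cube)
    also have "(D ?t)\<^sup>2 - ((cos ?t * (b + w * cos ?t) - w * (sin ?t)\<^sup>2) * D ?t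
        + 2 * b * (sin ?t)\<^sup>2 * (b + w * cos ?t)) = 2 * q\<^sup>2 * (sin ?t)\<^sup>2"
      unfolding D_def q sin_squared_eq by (simp add: algebra_simps power2_eq_square)
    finally show ?thesis using qnz by simp
  qed
  show thesis
  proof
    show "((\<lambda>t. F (of_real t)) has_vector_derivative
        of_real ((sin t)\<^sup>2) / (w + b * of_real (cos t)) ^ 3) (at t)" for t
      using has_vector_derivative_real_field[OF F[of t]] by (simp add: D_def cos_of_real sin_of_real)
    show "F (of_real pi) - F (of_real 0) = of_real pi / (2 * q ^ 3)"
    proof -
      have "F (of_real pi) - F (of_real 0) = (G (of_real pi) - G 0) / (2 * q\<^sup>2)"
        by (simp add: F_def sin_of_real diff_divide_distrib)
      then show ?thesis
        unfolding half using qnz by (simp add: field_simps eval_nat_numeral)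
    qed
  qed
qed

text \<open>The substitution \<open>x = X0 + r cos t\<close>. The antiderivative is a function of \<open>arccos\<close>, which is not
differentiable at the end points; continuity there suffices.\<close>

lemma semicircle_cube_integral:
  fixes X0 r s :: real and q :: complex
  assumes "r > 0" and q: "q\<^sup>2 = (of_real s - \<i> * of_real X0)\<^sup>2 + of_real (r\<^sup>2)"
    and pos: "Re (q * cnj (of_real s - \<i> * of_real X0)) > 0"
  shows "((\<lambda>x. of_real (sqrt (r\<^sup>2 - (x - X0)\<^sup>2)) / (of_real s - \<i> * of_real x) ^ 3) has_integral
           of_real (pi * r\<^sup>2) / (2 * q ^ 3)) {X0 - r..X0 + r}"
proof -
  define w where "w = of_real s - \<i> * of_real X0"
  define b where "b = - (\<i> * of_real r)"
  have "q\<^sup>2 = w\<^sup>2 - b\<^sup>2"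
    using q by (simp add: w_def b_def power_mult_distrib)
  then obtain F :: "real \<Rightarrow> complex"
    where F: "\<And>t. (F has_vector_derivative of_real ((sin t)\<^sup>2) / (w + b * of_real (cos t)) ^ 3) (at t)"
      and half: "F pi - F 0 = of_real pi / (2 * q ^ 3)"
    using trig_linear_sin_antiderivative[of q w b] pos unfolding w_def by metis
  define g where "g = (\<lambda>x. (x - X0) / r)"
  define H where "H = (\<lambda>x. - of_real (r\<^sup>2) * F (arccos (g x)))"
  have "((\<lambda>x. of_real (sqrt (r\<^sup>2 - (x - X0)\<^sup>2)) / (of_real s - \<i> * of_real x) ^ 3) has_integral
      H (X0 + r) - H (X0 - r)) {X0 - r..X0 + r}"
  proof (rule fundamental_theorem_of_calculus_interior)
    show "X0 - r \<le> X0 + r" using \<open>r > 0\<close> by simp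
    have "continuous_on UNIV F"
      using F by (meson continuous_at_imp_continuous_on has_vector_derivative_continuous)
    moreover have "continuous_on {X0 - r..X0 + r} (\<lambda>x. arccos (g x))"
      using \<open>r > 0\<close> by (auto intro!: continuous_intros simp: g_def field_simps)
    ultimately have "continuous_on {X0 - r..X0 + r} (\<lambda>x. F (arccos (g x)))"
      by (rule continuous_on_compose2) simp
    then show "continuous_on {X0 - r..X0 + r} H"
      unfolding H_def by (intro continuous_on_mult continuous_on_const)
  next
    fix x assume x: "x \<in> {X0 - r<..<X0 + r}"
    then have g: "- 1 < g x" "g x < 1" using \<open>r > 0\<close> by (auto simp: g_def field_simps)
    define t where "t = arccos (g x)"
    have ct: "cos t = g x" using g by (simp add: t_def)
    have st: "sin t = sqrt (1 - (g x)\<^sup>2)" using g by (simp add: t_def sin_arccos)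
    have "(g x)\<^sup>2 < 1" using g by (simp add: abs_square_less_1 abs_less_iff)
    then have st0: "sin t > 0" by (simp add: st)
    have dg: "(g has_real_derivative 1 / r) (at x)"
      unfolding g_def using \<open>r > 0\<close> by (auto intro!: derivative_eq_intros)
    have "((\<lambda>x. arccos (g x)) has_real_derivative inverse (- sqrt (1 - (g x)\<^sup>2)) * (1 / r)) (at x)"
      using DERIV_chain2[OF DERIV_arccos[OF g] dg] .
    then have da: "((\<lambda>x. arccos (g x)) has_vector_derivative (- 1 / (r * sin t))) (at x)"
      using st0 \<open>r > 0\<close>
      by (simp add: has_real_derivative_iff_has_vector_derivative st field_simps)
    have "(F \<circ> (\<lambda>x. arccos (g x)) has_vector_derivative
        (- 1 / (r * sin t)) *\<^sub>R (of_real ((sin t)\<^sup>2) / (w + b * of_real (cos t)) ^ 3)) (at x)"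
      using vector_diff_chain_at[OF da] F[of t] unfolding t_def by blast
    then have "(H has_vector_derivative - of_real (r\<^sup>2) *
        ((- 1 / (r * sin t)) *\<^sub>R (of_real ((sin t)\<^sup>2) / (w + b * of_real (cos t)) ^ 3))) (at x)"
      unfolding H_def o_def by (rule has_vector_derivative_mult_right)
    also have "- of_real (r\<^sup>2) * ((- 1 / (r * sin t)) *\<^sub>R (of_real ((sin t)\<^sup>2) / (w + b * of_real (cos t)) ^ 3))
        = of_real (r * sin t) / (w + b * of_real (cos t)) ^ 3"
      using st0 \<open>r > 0\<close> by (simp add: scaleR_conv_of_real field_simps power2_eq_square)
    also have "r * sin t = sqrt (r\<^sup>2 - (x - X0)\<^sup>2)"
    proof -
      have "r * sin t = sqrt (r\<^sup>2 * (1 - (g x)\<^sup>2))"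
        using \<open>r > 0\<close> by (simp add: st real_sqrt_mult)
      also have "r\<^sup>2 * (1 - (g x)\<^sup>2) = r\<^sup>2 - (x - X0)\<^sup>2"
        using \<open>r > 0\<close> by (simp add: g_def power_divide field_simps)
      finally show ?thesis .
    qed
    also have "w + b * of_real (cos t) = of_real s - \<i> * of_real x"
      using \<open>r > 0\<close> by (simp add: ct g_def w_def b_def field_simps)
    finally show "(H has_vector_derivative of_real (sqrt (r\<^sup>2 - (x - X0)\<^sup>2)) /
        (of_real s - \<i> * of_real x) ^ 3) (at x)" .
  qed
  moreover have "H (X0 + r) - H (X0 - r) = of_real (r\<^sup>2) * (F pi - F 0)"
    using \<open>r > 0\<close> by (simp add: H_def g_def algebra_simps)
  ultimately show ?thesis by (simp add: half mult_ac)
qed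

section \<open>Area on planes in an arbitrary orthonormal frame\<close>

text \<open>If \<open>p \<noteq> 0\<close>, the map is a composition of one-dimensional affine substitutions in the first and in
the second variable, with scaling factors \<open>p\<close> and \<open>(p t - q r) / p\<close>, so Fubini's theorem applies. Exchanging
the variables reduces \<open>p = 0\<close> to this case, because then \<open>q \<noteq> 0\<close>.\<close>

lemma distr_lborel_unimodular:
  fixes p q r t :: real
  assumes det: "\<bar>p * t - q * r\<bar> = 1"
  shows "distr (lborel :: (real \<times> real) measure) borel (\<lambda>(x, y). (p * x + q * y, r * x + t * y)) = lborel"
proof -
  have pivot: "(\<integral>\<^sup>+z. f (p * fst z + q * snd z, r * fst z + t * snd z) \<partial>lborel) = (\<integral>\<^sup>+z. f z \<partial>lborel)"
    if f[measurable]: "f \<in> borel_measurable borel" and "p \<noteq> 0" and det: "\<bar>p * t - q * r\<bar> = 1"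
    for f :: "real \<times> real \<Rightarrow> ennreal" and p q r t
  proof -
    have f'[measurable]: "f \<in> borel_measurable (borel \<Otimes>\<^sub>M borel)"
      by (simp add: borel_prod)
    have f'': "f \<in> borel_measurable (lborel \<Otimes>\<^sub>M lborel)"
      by (simp add: lborel_prod)
    let ?d = "p * t - q * r"
    have d0: "?d / p \<noteq> 0" using det \<open>p \<noteq> 0\<close> by auto
    have "ennreal \<bar>p\<bar> * (\<integral>\<^sup>+z. f (p * fst z + q * snd z, r * fst z + t * snd z) \<partial>lborel)
        = ennreal \<bar>p\<bar> * (\<integral>\<^sup>+y. (\<integral>\<^sup>+x. f (p * x + q * y, r * x + t * y) \<partial>lborel) \<partial>lborel)"
      unfolding lborel_prod[symmetric] by (subst lborel_pair.nn_integral_snd[symmetric]) auto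
    also have "\<dots> = (\<integral>\<^sup>+y. ennreal \<bar>p\<bar> * (\<integral>\<^sup>+x. f (p * x + q * y, r * x + t * y) \<partial>lborel) \<partial>lborel)"
      by (subst nn_integral_cmult) auto
    also have "\<dots> = (\<integral>\<^sup>+y. (\<integral>\<^sup>+u. f (u, r / p * u + ?d / p * y) \<partial>lborel) \<partial>lborel)"
    proof (rule nn_integral_cong)
      fix y :: real
      have "(\<integral>\<^sup>+u. f (u, r / p * u + ?d / p * y) \<partial>lborel)
          = ennreal \<bar>p\<bar> * (\<integral>\<^sup>+x. f (q * y + p * x, r / p * (q * y + p * x) + ?d / p * y) \<partial>lborel)"
        by (rule nn_integral_real_affine) (use \<open>p \<noteq> 0\<close> in auto)
      also have "(\<lambda>x. f (q * y + p * x, r / p * (q * y + p * x) + ?d / p * y))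
          = (\<lambda>x. f (p * x + q * y, r * x + t * y))"
        using \<open>p \<noteq> 0\<close> by (intro ext arg_cong[where f = f]) (simp add: field_simps)
      finally show "ennreal \<bar>p\<bar> * (\<integral>\<^sup>+x. f (p * x + q * y, r * x + t * y) \<partial>lborel)
          = (\<integral>\<^sup>+u. f (u, r / p * u + ?d / p * y) \<partial>lborel)" ..
    qed
    also have "\<dots> = (\<integral>\<^sup>+u. (\<integral>\<^sup>+y. f (u, r / p * u + ?d / p * y) \<partial>lborel) \<partial>lborel)"
      by (rule lborel_pair.Fubini') auto
    also have "\<dots> = (\<integral>\<^sup>+u. ennreal \<bar>p\<bar> * (\<integral>\<^sup>+v. f (u, v) \<partial>lborel) \<partial>lborel)"
    proof (rule nn_integral_cong)
      fix u :: real
      have "ennreal \<bar>p\<bar> * (\<integral>\<^sup>+v. f (u, v) \<partial>lborel)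
          = ennreal \<bar>p\<bar> * (ennreal \<bar>?d / p\<bar> * (\<integral>\<^sup>+y. f (u, r / p * u + ?d / p * y) \<partial>lborel))"
        by (subst nn_integral_real_affine[OF _ d0, of _ "r / p * u"]) auto
      also have "\<dots> = (\<integral>\<^sup>+y. f (u, r / p * u + ?d / p * y) \<partial>lborel)"
        using \<open>p \<noteq> 0\<close> det by (simp add: mult.assoc[symmetric] ennreal_mult[symmetric] abs_divide)
      finally show "(\<integral>\<^sup>+y. f (u, r / p * u + ?d / p * y) \<partial>lborel)
          = ennreal \<bar>p\<bar> * (\<integral>\<^sup>+v. f (u, v) \<partial>lborel)" ..
    qed
    also have "\<dots> = ennreal \<bar>p\<bar> * (\<integral>\<^sup>+z. f z \<partial>lborel)"
      unfolding lborel_prod[symmetric]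
      by (subst nn_integral_cmult) (simp_all only: lborel.nn_integral_fst[OF f''], measurable)
    finally show ?thesis
      using \<open>p \<noteq> 0\<close> by (simp add: ennreal_mult_cancel_left)
  qed
  have "(\<integral>\<^sup>+z. f (p * fst z + q * snd z, r * fst z + t * snd z) \<partial>lborel) = (\<integral>\<^sup>+z. f z \<partial>lborel)"
    if f[measurable]: "f \<in> borel_measurable borel" for f :: "real \<times> real \<Rightarrow> ennreal"
  proof (cases "p = 0")
    case False
    then show ?thesis using pivot[OF f _ det] by simp
  next
    case True
    have f'[measurable]: "f \<in> borel_measurable (borel \<Otimes>\<^sub>M borel)"
      by (simp add: borel_prod)
    have "(\<integral>\<^sup>+z. f (p * fst z + q * snd z, r * fst z + t * snd z) \<partial>lborel)
        = (\<integral>\<^sup>+z. f (q * fst z + p * snd z, t * fst z + r * snd z) \<partial>lborel)"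
      unfolding lborel_prod[symmetric]
      by (subst lborel.nn_integral_fst[symmetric], simp, subst lborel_pair.nn_integral_snd[symmetric])
         (simp_all add: add.commute)
    also have "\<dots> = (\<integral>\<^sup>+z. f z \<partial>lborel)"
      using True det by (intro pivot[OF f]) (auto simp: abs_minus_commute)
    finally show ?thesis .
  qed note inv = this
  show ?thesis
  proof (rule measure_eqI)
    fix A assume "A \<in> sets (distr (lborel :: (real \<times> real) measure) borel
        (\<lambda>(x, y). (p * x + q * y, r * x + t * y)))"
    then have A[measurable]: "A \<in> sets borel" by simp
    have "emeasure (distr (lborel :: (real \<times> real) measure) borel
        (\<lambda>z. (p * fst z + q * snd z, r * fst z + t * snd z))) A
        = (\<integral>\<^sup>+z. indicator A z \<partial>distr lborel borel (\<lambda>z. (p * fst z + q * snd z, r * fst z + t * snd z)))"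
      by (simp del: borel_prod)
    also have "\<dots> = (\<integral>\<^sup>+z. indicator A (p * fst z + q * snd z, r * fst z + t * snd z) \<partial>lborel)"
      by (subst nn_integral_distr) (auto intro!: borel_measurable_continuous_onI continuous_intros)
    also have "\<dots> = emeasure lborel A" by (subst inv) auto
    finally show "emeasure (distr (lborel :: (real \<times> real) measure) borel
        (\<lambda>(x, y). (p * x + q * y, r * x + t * y))) A = emeasure lborel A"
      by (simp add: case_prod_beta')
  qed simp
qed

lemma orthonormal_expansion_3:
  fixes a b c x :: "real^3"
  assumes "norm a = 1" "norm b = 1" "norm c = 1" "a \<bullet> b = 0" "a \<bullet> c = 0" "b \<bullet> c = 0"
  shows "x = (x \<bullet> a) *\<^sub>R a + (x \<bullet> b) *\<^sub>R b + (x \<bullet> c) *\<^sub>R c"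
proof -
  have sq: "a \<bullet> a = 1" "b \<bullet> b = 1" "c \<bullet> c = 1"
    using assms by (simp_all add: dot_square_norm)
  have ne: "a \<noteq> b" "a \<noteq> c" "b \<noteq> c" "a \<noteq> 0" "b \<noteq> 0" "c \<noteq> 0"
    using assms sq by auto
  have "pairwise orthogonal {a, b, c}"
    using assms by (auto simp: pairwise_insert orthogonal_def inner_commute)
  then have "independent {a, b, c}"
    using ne by (intro pairwise_orthogonal_independent) auto
  then have "span {a, b, c} = UNIV"
    using ne card_eq_dim[of "{a, b, c}" UNIV] by auto
  define y where "y = x - ((x \<bullet> a) *\<^sub>R a + (x \<bullet> b) *\<^sub>R b + (x \<bullet> c) *\<^sub>R c)"
  have "orthogonal y z" if "z \<in> {a, b, c}" for z
    using that assms sq by (auto simp: orthogonal_def y_def inner_simps inner_commute)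
  then have "orthogonal y y"
    using orthogonal_to_span[of y "{a, b, c}" y] \<open>span {a, b, c} = UNIV\<close> by (auto simp: orthogonal_commute)
  then show ?thesis by (simp add: orthogonal_def y_def)
qed

lemma orthonormal_norm_3:
  fixes a b c x :: "real^3"
  assumes "norm a = 1" "norm b = 1" "norm c = 1" "a \<bullet> b = 0" "a \<bullet> c = 0" "b \<bullet> c = 0"
  shows "(norm x)\<^sup>2 = (x \<bullet> a)\<^sup>2 + (x \<bullet> b)\<^sup>2 + (x \<bullet> c)\<^sup>2"
proof -
  have "x \<bullet> x = x \<bullet> ((x \<bullet> a) *\<^sub>R a + (x \<bullet> b) *\<^sub>R b + (x \<bullet> c) *\<^sub>R c)"
    by (rule arg_cong[where f = "\<lambda>y. x \<bullet> y"], rule orthonormal_expansion_3[OF assms])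
  also have "\<dots> = (x \<bullet> a)\<^sup>2 + (x \<bullet> b)\<^sup>2 + (x \<bullet> c)\<^sup>2"
    by (simp only: inner_add_right inner_scaleR_right power2_eq_square)
  finally show ?thesis by (simp only: power2_norm_eq_inner)
qed

definition perp_orthonormal :: "real^3 \<Rightarrow> real^3 \<Rightarrow> real^3 \<Rightarrow> bool" where
  "perp_orthonormal \<omega> a b \<longleftrightarrow> norm a = 1 \<and> norm b = 1 \<and> a \<bullet> b = 0 \<and> a \<bullet> \<omega> = 0 \<and> b \<bullet> \<omega> = 0"

lemma perp_orthonormal_exists:
  assumes "norm \<omega> = 1" "norm a = 1" "a \<bullet> \<omega> = 0"
  shows "\<exists>b. perp_orthonormal \<omega> a b"
proof -
  have "norm (cross3 \<omega> a) = 1"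
    using norm_cross_dot[of \<omega> a] assms by (simp add: inner_commute power2_eq_square square_eq_1_iff)
      (smt (verit) norm_ge_zero)
  then show ?thesis
    using assms by (intro exI[of _ "cross3 \<omega> a"]) (simp add: perp_orthonormal_def dot_cross_self)
qed

lemma perp_frame_orthonormal:
  assumes "norm \<omega> = 1"
  shows "perp_orthonormal \<omega> (fst (perp_frame \<omega>)) (snd (perp_frame \<omega>))"
proof -
  have "2 \<le> DIM(real^3)" by simp
  then obtain v where v: "v \<noteq> 0" "orthogonal \<omega> v"
    using orthogonal_to_vector_exists[of \<omega>] by metis
  define a where "a = v /\<^sub>R norm v"
  have "norm a = 1" "a \<bullet> \<omega> = 0"
    using v by (auto simp: a_def orthogonal_def inner_commute)
  then obtain b where "perp_orthonormal \<omega> a b"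
    using perp_orthonormal_exists[OF assms] by blast
  then have "\<exists>z. case z of (a, b) \<Rightarrow> perp_orthonormal \<omega> a b"
    by (intro exI[of _ "(a, b)"]) simp
  from someI_ex[OF this] show ?thesis
    unfolding perp_frame_def perp_orthonormal_def by (simp add: case_prod_beta')
qed

text \<open>Two orthonormal frames of the same plane differ by an orthogonal \<open>2 \<times> 2\<close> matrix, whose
determinant is \<open>\<plusminus>1\<close>. This frees the computation of area from the unspecified frame in the
definition.\<close>

lemma plane_area_orthonormal:
  assumes \<omega>: "norm \<omega> = 1" and ab: "perp_orthonormal \<omega> a b"
  shows "plane_area \<omega> c = distr (lborel :: (real \<times> real) measure) borel
           (\<lambda>(x, y). c *\<^sub>R \<omega> + x *\<^sub>R a + y *\<^sub>R b)"
proof -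
  obtain a0 b0 where fr: "perp_frame \<omega> = (a0, b0)" by (cases "perp_frame \<omega>")
  have ab0: "perp_orthonormal \<omega> a0 b0"
    using perp_frame_orthonormal[OF \<omega>] by (simp add: fr)
  have ex: "v = (v \<bullet> a0) *\<^sub>R a0 + (v \<bullet> b0) *\<^sub>R b0" if "v \<bullet> \<omega> = 0" for v
    using orthonormal_expansion_3[of a0 b0 \<omega> v] ab0 \<omega> that by (simp add: perp_orthonormal_def)
  define p q r t where "p = a \<bullet> a0" and "q = b \<bullet> a0" and "r = a \<bullet> b0" and "t = b \<bullet> b0"
  have a: "a = p *\<^sub>R a0 + r *\<^sub>R b0" and b: "b = q *\<^sub>R a0 + t *\<^sub>R b0"
    using ex[of a] ex[of b] ab by (simp_all add: perp_orthonormal_def p_def q_def r_def t_def)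
  have sq: "a0 \<bullet> a0 = 1" "b0 \<bullet> b0 = 1" "a0 \<bullet> b0 = 0" "b0 \<bullet> a0 = 0"
      "a \<bullet> a = 1" "b \<bullet> b = 1" "a \<bullet> b = 0"
    using ab ab0 by (simp_all add: perp_orthonormal_def dot_square_norm inner_commute)
  have rel: "p\<^sup>2 + r\<^sup>2 = 1" "q\<^sup>2 + t\<^sup>2 = 1" "p * q + r * t = 0"
    using sq(5-7) unfolding a b by (simp_all add: inner_simps sq power2_eq_square mult.commute)
  \<comment> \<open>Lagrange's identity\<close>
  have "(p * t - q * r)\<^sup>2 = (p\<^sup>2 + r\<^sup>2) * (q\<^sup>2 + t\<^sup>2) - (p * q + r * t)\<^sup>2"
    by (simp add: power2_eq_square algebra_simps)
  then have "\<bar>p * t - q * r\<bar> = 1"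
    using rel by (auto simp: power2_eq_1_iff)
  note inv = distr_lborel_unimodular[OF this]
  have "plane_area \<omega> c = distr lborel borel (\<lambda>(x, y). c *\<^sub>R \<omega> + x *\<^sub>R a0 + y *\<^sub>R b0)"
    by (simp add: plane_area_def fr)
  also have "\<dots> = distr (distr lborel borel (\<lambda>(x, y). (p * x + q * y, r * x + t * y))) borel
      (\<lambda>(x, y). c *\<^sub>R \<omega> + x *\<^sub>R a0 + y *\<^sub>R b0)"
    unfolding inv ..
  also have "\<dots> = distr lborel borel ((\<lambda>(x, y). c *\<^sub>R \<omega> + x *\<^sub>R a0 + y *\<^sub>R b0) \<circ>
      (\<lambda>(x, y). (p * x + q * y, r * x + t * y)))"
    by (rule distr_distr)
      (auto intro!: borel_measurable_continuous_onI continuous_intros simp: case_prod_beta')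
  also have "(\<lambda>(x, y). c *\<^sub>R \<omega> + x *\<^sub>R a0 + y *\<^sub>R b0) \<circ> (\<lambda>(x, y). (p * x + q * y, r * x + t * y))
      = (\<lambda>(x, y). c *\<^sub>R \<omega> + x *\<^sub>R a + y *\<^sub>R b)"
    unfolding a b by (auto simp: fun_eq_iff algebra_simps)
  finally show ?thesis .
qed

text \<open>The freedom in the base point \<open>p\<close> allows coordinates centred below the apex of a cone.\<close>

lemma plane_area_through:
  assumes \<omega>: "norm \<omega> = 1" and ab: "perp_orthonormal \<omega> a b" and p: "p \<bullet> \<omega> = c"
  shows "plane_area \<omega> c = distr (lborel :: (real \<times> real) measure) borel
           (\<lambda>(x, y). p + x *\<^sub>R a + y *\<^sub>R b)"
proof -
  have p_eq: "p = c *\<^sub>R \<omega> + (p \<bullet> a) *\<^sub>R a + (p \<bullet> b) *\<^sub>R b"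
    using orthonormal_expansion_3[of a b \<omega> p] ab \<omega> p by (simp add: perp_orthonormal_def add_ac)
  have "plane_area \<omega> c = distr (distr lborel borel ((+) (p \<bullet> a, p \<bullet> b))) borel
      (\<lambda>(x, y). c *\<^sub>R \<omega> + x *\<^sub>R a + y *\<^sub>R b)"
    unfolding plane_area_orthonormal[OF \<omega> ab] lborel_distr_plus ..
  also have "\<dots> = distr lborel borel ((\<lambda>(x, y). c *\<^sub>R \<omega> + x *\<^sub>R a + y *\<^sub>R b) \<circ> (+) (p \<bullet> a, p \<bullet> b))"
    by (rule distr_distr)
      (auto intro!: borel_measurable_continuous_onI continuous_intros simp: case_prod_beta')
  also have "(\<lambda>(x, y). c *\<^sub>R \<omega> + x *\<^sub>R a + y *\<^sub>R b) \<circ> (+) (p \<bullet> a, p \<bullet> b)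
      = (\<lambda>(x, y). (c *\<^sub>R \<omega> + (p \<bullet> a) *\<^sub>R a + (p \<bullet> b) *\<^sub>R b) + x *\<^sub>R a + y *\<^sub>R b)"
    by (auto simp: fun_eq_iff algebra_simps)
  finally show ?thesis unfolding p_eq[symmetric] .
qed

lemma plane_area_integral:
  fixes f :: "real^3 \<Rightarrow> complex"
  assumes \<omega>: "norm \<omega> = 1" and ab: "perp_orthonormal \<omega> a b" and p: "p \<bullet> \<omega> = c"
    and [measurable]: "A \<in> sets borel" "f \<in> borel_measurable borel"
  shows "(LINT z:A|plane_area \<omega> c. f z) =
    (LINT z|lborel. indicator A (p + fst z *\<^sub>R a + snd z *\<^sub>R b) *\<^sub>R
       f (p + fst z *\<^sub>R a + snd z *\<^sub>R b))"
proof -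
  have [measurable]: "(\<lambda>z. p + fst z *\<^sub>R a + snd z *\<^sub>R b) \<in> borel_measurable (borel :: (real \<times> real) measure)"
    by (intro borel_measurable_continuous_onI continuous_intros)
  show ?thesis
    unfolding plane_area_through[OF \<omega> ab p] set_lebesgue_integral_def case_prod_beta'
    by (subst integral_distr) auto
qed

section \<open>The integral over an elliptic section\<close>

lemma power2_less_power2_iff_abs:
  fixes x h :: real
  assumes "h \<ge> 0"
  shows "x\<^sup>2 < h\<^sup>2 \<longleftrightarrow> \<bar>x\<bar> < h"
  using abs_le_square_iff[of h x] assms by (simp add: not_le[symmetric])

text \<open>Here \<open>\<gamma>, \<mu>, \<nu>\<close> are the coordinates of the cone axis, \<open>c\<close> and \<open>S\<close> are cosine and sine of the half-angle, and
\<open>R\<close> is the section at distance \<open>s\<close> from the apex. For fixed \<open>x\<close> put \<open>U = \<gamma> s - \<mu> x\<close>. Squaring the cone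
inequality gives \<open>(B y + \<nu> U)\<^sup>2 < c\<^sup>2 (U\<^sup>2 - B (s\<^sup>2 + x\<^sup>2))\<close> with \<open>B = c\<^sup>2 - \<nu>\<^sup>2\<close>, and the right-hand side is
\<open>c\<^sup>2 a (r\<^sup>2 - (x - X0)\<^sup>2)\<close> with \<open>a = \<gamma>\<^sup>2 - S\<^sup>2 > 0\<close>. So the chord over \<open>x\<close> has length
\<open>\<kappa> \<surd>(r\<^sup>2 - (x - X0)\<^sup>2)\<close>, and the integral reduces to the semicircle integral. The
power \<open>3/2\<close> that it produces becomes a cube because \<open>(s - \<i> X0)\<^sup>2 + r\<^sup>2\<close> happens to be a perfect square, namely
\<open>s\<^sup>2 (\<gamma> + \<i> \<mu>)\<^sup>2 / a\<close>.\<close>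

lemma cone_section_integral:
  fixes \<gamma> \<mu> \<nu> c S s :: real
  assumes unit: "\<gamma>\<^sup>2 + \<mu>\<^sup>2 + \<nu>\<^sup>2 = 1" and cS: "c\<^sup>2 + S\<^sup>2 = 1"
    and pos: "c > 0" "S > 0" "s > 0" and steep: "\<gamma> > S"
  defines "R \<equiv> {z :: real \<times> real. \<gamma> * s - \<mu> * fst z - \<nu> * snd z > c * sqrt (s\<^sup>2 + (fst z)\<^sup>2 + (snd z)\<^sup>2)}"
  shows "(LINT z|lborel. indicator R z *\<^sub>R (1 / (of_real s - \<i> * of_real (fst z)) ^ 3))
           = of_real (pi * c * S\<^sup>2) / (of_real s * (of_real \<gamma> + \<i> * of_real \<mu>) ^ 3)"
proof -
  define a where "a = \<gamma>\<^sup>2 - S\<^sup>2"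
  define B where "B = c\<^sup>2 - \<nu>\<^sup>2"
  define X0 where "X0 = - (\<gamma> * \<mu> * s / a)"
  define r where "r = s * S * sqrt B / a"
  define f where "f = (\<lambda>x::real. 1 / (of_real s - \<i> * of_real x) ^ 3 :: complex)"
  have "S\<^sup>2 < \<gamma>\<^sup>2" using pos steep by (intro power_strict_mono) auto
  then have a0: "a > 0" by (simp add: a_def)
  have Ba: "B = a + \<mu>\<^sup>2" using unit cS by (simp add: a_def B_def)
  then have B0: "B > 0" using a0 by (simp add: add_pos_nonneg)
  have r0: "r > 0" using pos a0 B0 by (simp add: r_def)
  have r2: "r\<^sup>2 = s\<^sup>2 * S\<^sup>2 * B / a\<^sup>2"
    using B0 by (simp add: r_def power_mult_distrib power_divide)
  have f0: "of_real s - \<i> * of_real x \<noteq> 0" for x :: real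
    using pos by (auto simp: complex_eq_iff)
  have disc: "(\<gamma> * s - \<mu> * x)\<^sup>2 - B * (s\<^sup>2 + x\<^sup>2) = a * (r\<^sup>2 - (x - X0)\<^sup>2)" for x
  proof -
    have "a * (a * (r\<^sup>2 - (x - X0)\<^sup>2)) = a\<^sup>2 * r\<^sup>2 - (a * (x - X0))\<^sup>2"
      by (simp add: algebra_simps power2_eq_square)
    also have "a\<^sup>2 * r\<^sup>2 = s\<^sup>2 * S\<^sup>2 * B" using a0 by (simp add: r2)
    also have "a * (x - X0) = a * x + \<gamma> * \<mu> * s" using a0 by (simp add: X0_def algebra_simps)
    also have "s\<^sup>2 * S\<^sup>2 * B - (a * x + \<gamma> * \<mu> * s)\<^sup>2
        = a * ((\<gamma> * s - \<mu> * x)\<^sup>2 - B * (s\<^sup>2 + x\<^sup>2))"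
      unfolding Ba a_def by (simp add: algebra_simps power2_eq_square)
    finally show ?thesis using a0 by simp
  qed
  have mem: "(x, y) \<in> R \<longleftrightarrow> (B * y + \<nu> * (\<gamma> * s - \<mu> * x))\<^sup>2 < c\<^sup>2 * (a * (r\<^sup>2 - (x - X0)\<^sup>2))" for x y
  proof -
    define U where "U = \<gamma> * s - \<mu> * x"
    define M where "M = s\<^sup>2 + x\<^sup>2"
    have M0: "M > 0" using pos by (simp add: M_def add_pos_nonneg)
    have sq: "(U - \<nu> * y)\<^sup>2 > c\<^sup>2 * (M + y\<^sup>2) \<longleftrightarrow> (B * y + \<nu> * U)\<^sup>2 < c\<^sup>2 * (U\<^sup>2 - B * M)"
    proof -
      have "c\<^sup>2 * (U\<^sup>2 - B * M) - (B * y + \<nu> * U)\<^sup>2 = B * ((U - \<nu> * y)\<^sup>2 - c\<^sup>2 * (M + y\<^sup>2))"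
        unfolding B_def by (simp add: algebra_simps power2_eq_square)
      moreover have "B * ((U - \<nu> * y)\<^sup>2 - c\<^sup>2 * (M + y\<^sup>2)) > 0 \<longleftrightarrow> (U - \<nu> * y)\<^sup>2 - c\<^sup>2 * (M + y\<^sup>2) > 0"
        using B0 by (simp add: zero_less_mult_iff)
      ultimately show ?thesis by linarith
    qed
    have R: "(x, y) \<in> R \<longleftrightarrow> U - \<nu> * y > c * sqrt (M + y\<^sup>2)"
      by (simp add: R_def U_def M_def)
    have root: "(c * sqrt (M + y\<^sup>2))\<^sup>2 = c\<^sup>2 * (M + y\<^sup>2)" "c * sqrt (M + y\<^sup>2) \<ge> 0"
      using M0 pos by (simp_all add: power_mult_distrib)
    have "(x, y) \<in> R" if h: "(B * y + \<nu> * U)\<^sup>2 < c\<^sup>2 * (U\<^sup>2 - B * M)"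
    proof -
      have "0 < c\<^sup>2 * (U\<^sup>2 - B * M)" using h by (rule le_less_trans[OF zero_le_power2])
      then have UM: "B * M < U\<^sup>2" using pos by (simp add: zero_less_mult_iff)
      \<comment> \<open>Where \<open>U \<le> 0\<close> the squared inequality fails, so squaring adds no points of the opposite nappe.\<close>
      have "U > 0"
      proof (rule ccontr)
        assume "\<not> U > 0"
        then have "0 \<le> \<mu> * x - \<gamma> * s" "0 < \<gamma> * s" using pos steep by (auto simp: U_def)
        then have "(\<mu> * x - \<gamma> * s)\<^sup>2 \<le> (\<mu> * x)\<^sup>2" by (intro power_mono) auto
        also have "\<dots> \<le> B * M"
          using a0 M0 by (simp add: Ba M_def power_mult_distrib algebra_simps)
        finally show False using UM by (simp add: U_def power2_commute)
      qed
      have "(B * y + \<nu> * U)\<^sup>2 < (c * U)\<^sup>2"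
      proof -
        have "c\<^sup>2 * (U\<^sup>2 - B * M) \<le> c\<^sup>2 * U\<^sup>2"
          using B0 M0 by (intro mult_left_mono) auto
        with h show ?thesis by (simp add: power_mult_distrib)
      qed
      then have "\<bar>B * y + \<nu> * U\<bar> < c * U"
        using pos \<open>U > 0\<close> by (subst (asm) power2_less_power2_iff_abs) auto
      moreover have "\<bar>\<nu>\<bar> \<le> c"
        using B0 pos power2_le_imp_le[of "\<bar>\<nu>\<bar>" c] by (simp add: B_def)
      ultimately have "\<bar>\<nu>\<bar> * \<bar>B * y + \<nu> * U\<bar> \<le> c * \<bar>B * y + \<nu> * U\<bar>"
          "c * \<bar>B * y + \<nu> * U\<bar> < c * (c * U)"
        using pos by (simp_all add: mult_right_mono mult_strict_left_mono)
      then have "\<bar>\<nu> * (B * y + \<nu> * U)\<bar> < c * (c * U)"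
        unfolding abs_mult by linarith
      moreover have "B * (U - \<nu> * y) = c * (c * U) - \<nu> * (B * y + \<nu> * U)"
        unfolding B_def by (simp add: algebra_simps power2_eq_square)
      ultimately have "B * (U - \<nu> * y) > 0" by linarith
      then have "U - \<nu> * y > 0" using B0 by (simp add: zero_less_mult_iff)
      then show ?thesis
        unfolding R using h sq root by (intro power2_less_imp_less[of "c * sqrt (M + y\<^sup>2)"]) auto
    qed
    moreover have "(B * y + \<nu> * U)\<^sup>2 < c\<^sup>2 * (U\<^sup>2 - B * M)" if "(x, y) \<in> R"
    proof -
      have "(c * sqrt (M + y\<^sup>2))\<^sup>2 < (U - \<nu> * y)\<^sup>2"
        using that root unfolding R by (intro power_strict_mono) auto
      then show ?thesis using sq root by simp
    qed
    ultimately show ?thesis using disc[of x] unfolding U_def M_def by auto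
  qed
  have openR: "open R"
    unfolding R_def by (intro open_Collect_less continuous_intros)
  then have R_borel: "R \<in> sets (lborel :: (real \<times> real) measure)" by simp
  have bR: "bounded R"
  proof -
    define m where "m = norm (\<mu>, \<nu>)"
    have "m\<^sup>2 < c\<^sup>2" using a0 Ba by (simp add: m_def norm_Pair B_def)
    then have m: "m < c" by (rule power2_less_imp_less) (use pos in simp)
    have "norm z \<le> \<gamma> * s / (c - m)" if "z \<in> R" for z
    proof -
      obtain x y where z: "z = (x, y)" by (cases z)
      have "c * norm z \<le> c * sqrt (s\<^sup>2 + x\<^sup>2 + y\<^sup>2)"
        using pos by (intro mult_left_mono) (simp_all add: z norm_Pair)
      also have "\<dots> < \<gamma> * s - \<mu> * x - \<nu> * y" using that by (simp add: R_def z)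
      also have "\<dots> \<le> \<gamma> * s + m * norm z"
        using norm_cauchy_schwarz[of "- (\<mu>, \<nu>)" z] by (simp add: z m_def norm_Pair)
      finally have "(c - m) * norm z \<le> \<gamma> * s" by (simp add: algebra_simps)
      then show ?thesis using m by (simp add: field_simps)
    qed
    then show ?thesis by (rule boundedI)
  qed
  have f_borel: "f \<in> borel_measurable borel"
    unfolding f_def by (intro borel_measurable_continuous_onI continuous_intros) (use f0 in auto)
  have int: "integrable (lborel :: (real \<times> real) measure) (\<lambda>z. indicator R z *\<^sub>R f (fst z))"
  proof (rule integrableI_bounded_set_indicator[OF R_borel])
    show "(\<lambda>z. f (fst z)) \<in> borel_measurable (lborel :: (real \<times> real) measure)"
      using f_borel by (simp add: borel_prod[symmetric])
    show "emeasure lborel R < \<infinity>" by (rule emeasure_bounded_finite[OF bR])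
    have "norm (f x) \<le> 1 / s ^ 3" for x
    proof -
      have "s \<le> norm (of_real s - \<i> * of_real x :: complex)"
        using complex_Re_le_cmod[of "of_real s - \<i> * of_real x"] by simp
      then show ?thesis
        using pos by (simp add: f_def norm_divide norm_power) (intro divide_left_mono power_mono; simp)
    qed
    then show "AE z in lborel. z \<in> R \<longrightarrow> norm (f (fst z)) \<le> 1 / s ^ 3" by simp
  qed
  define \<kappa> where "\<kappa> = 2 * c * sqrt a / B"
  have inner: "(LINT y|lborel. indicator R (x, y) *\<^sub>R f x)
      = indicator {X0 - r..X0 + r} x *\<^sub>R (of_real \<kappa> * (of_real (sqrt (r\<^sup>2 - (x - X0)\<^sup>2)) * f x))" for x
  proof -
    define h where "h = c * (sqrt a * sqrt (r\<^sup>2 - (x - X0)\<^sup>2))"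
    define U where "U = \<gamma> * s - \<mu> * x"
    show ?thesis
    proof (cases "x \<in> {X0 - r..X0 + r}")
      case True
      then have "(x - X0)\<^sup>2 \<le> r\<^sup>2" by (intro abs_le_square_iff[THEN iffD1]) auto
      then have h2: "c\<^sup>2 * (a * (r\<^sup>2 - (x - X0)\<^sup>2)) = h\<^sup>2" and h0: "h \<ge> 0"
        using a0 pos by (simp_all add: h_def power_mult_distrib)
      have "(x, y) \<in> R \<longleftrightarrow> y \<in> {(- h - \<nu> * U) / B<..<(h - \<nu> * U) / B}" for y
      proof -
        have "(x, y) \<in> R \<longleftrightarrow> \<bar>B * y + \<nu> * U\<bar> < h"
          unfolding mem h2 U_def[symmetric] by (rule power2_less_power2_iff_abs[OF h0])
        also have "\<dots> \<longleftrightarrow> y \<in> {(- h - \<nu> * U) / B<..<(h - \<nu> * U) / B}"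
          using B0 by (auto simp: field_simps abs_less_iff)
        finally show ?thesis .
      qed
      then have "(\<lambda>y. indicator R (x, y) *\<^sub>R f x)
          = (\<lambda>y. indicator {(- h - \<nu> * U) / B<..<(h - \<nu> * U) / B} y *\<^sub>R f x)"
        by (auto simp: indicator_def fun_eq_iff)
      moreover have le: "(- h - \<nu> * U) / B \<le> (h - \<nu> * U) / B"
        using h0 B0 by (intro divide_right_mono) auto
      then have "integrable lborel (indicator {(- h - \<nu> * U) / B<..<(h - \<nu> * U) / B} :: real \<Rightarrow> real)"
        by (intro integrable_real_indicator) auto
      ultimately have "(LINT y|lborel. indicator R (x, y) *\<^sub>R f x)
          = measure lborel {(- h - \<nu> * U) / B<..<(h - \<nu> * U) / B} *\<^sub>R f x"
        by simp
      also have "measure lborel {(- h - \<nu> * U) / B<..<(h - \<nu> * U) / B} = 2 * h / B"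
        using le B0 by (simp add: field_simps)
      finally show ?thesis
        using True by (simp add: h_def \<kappa>_def scaleR_conv_of_real mult_ac)
    next
      case False
      then have "r < \<bar>x - X0\<bar>" by auto
      then have "r\<^sup>2 < (x - X0)\<^sup>2" using r0 by (intro power_strict_mono[of r "\<bar>x - X0\<bar>" 2, simplified]) auto
      then have "c\<^sup>2 * (a * (r\<^sup>2 - (x - X0)\<^sup>2)) < 0" using a0 pos by (simp add: mult_pos_neg)
      then have "(x, y) \<notin> R" for y
        unfolding mem using zero_le_power2[of "B * y + \<nu> * (\<gamma> * s - \<mu> * x)"] by linarith
      then show ?thesis using False by simp
    qed
  qed
  define q where "q = of_real (s / sqrt a) * (of_real \<gamma> + \<i> * of_real \<mu> :: complex)"
  have q2: "q\<^sup>2 = (of_real s - \<i> * of_real X0)\<^sup>2 + of_real (r\<^sup>2)"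
  proof -
    have "Re (q\<^sup>2) = s\<^sup>2 * (\<gamma>\<^sup>2 - \<mu>\<^sup>2) / a"
      using a0 by (simp add: q_def power_mult_distrib power_divide power2_eq_square field_simps)
    also have "\<dots> = s\<^sup>2 - X0\<^sup>2 + r\<^sup>2"
    proof -
      have "a\<^sup>2 * (s\<^sup>2 - X0\<^sup>2 + r\<^sup>2) = a\<^sup>2 * s\<^sup>2 - (a * X0)\<^sup>2 + a\<^sup>2 * r\<^sup>2"
        by (simp add: algebra_simps power2_eq_square)
      also have "a * X0 = - (\<gamma> * \<mu> * s)" using a0 by (simp add: X0_def)
      also have "a\<^sup>2 * r\<^sup>2 = s\<^sup>2 * S\<^sup>2 * B" using a0 by (simp add: r2)
      also have "a\<^sup>2 * s\<^sup>2 - (- (\<gamma> * \<mu> * s))\<^sup>2 + s\<^sup>2 * S\<^sup>2 * B = a * (s\<^sup>2 * (\<gamma>\<^sup>2 - \<mu>\<^sup>2))"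
        unfolding Ba a_def by (simp add: algebra_simps power2_eq_square)
      finally have e: "a\<^sup>2 * (s\<^sup>2 - X0\<^sup>2 + r\<^sup>2) = a * (s\<^sup>2 * (\<gamma>\<^sup>2 - \<mu>\<^sup>2))" .
      have "V / a = W" if "a\<^sup>2 * W = a * V" for V W
        using that a0 by (simp add: power2_eq_square field_simps)
      from this[OF e] show ?thesis .
    qed
    finally have "Re (q\<^sup>2) = Re ((of_real s - \<i> * of_real X0)\<^sup>2 + of_real (r\<^sup>2))"
      by (simp add: power2_eq_square)
    moreover have "Im (q\<^sup>2) = Im ((of_real s - \<i> * of_real X0)\<^sup>2 + of_real (r\<^sup>2))"
      using a0 by (simp add: q_def X0_def power_mult_distrib power_divide power2_eq_square field_simps)
    ultimately show ?thesis by (rule complex_eqI)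
  qed
  have qpos: "Re (q * cnj (of_real s - \<i> * of_real X0)) > 0"
  proof -
    have "Re (q * cnj (of_real s - \<i> * of_real X0)) = s / sqrt a * (\<gamma> * s + \<gamma> * \<mu>\<^sup>2 * s / a)"
      by (simp add: q_def X0_def algebra_simps power2_eq_square)
    also have "\<dots> > 0" using pos a0 steep by (intro mult_pos_pos add_pos_nonneg) auto
    finally show ?thesis .
  qed
  let ?g = "\<lambda>x. of_real (sqrt (r\<^sup>2 - (x - X0)\<^sup>2)) * f x"
  have "set_integrable lborel {X0 - r..X0 + r} ?g"
    unfolding f_def using f0 by (intro borel_integrable_atLeastAtMost' continuous_intros) auto
  then have "(LINT x:{X0 - r..X0 + r}|lborel. ?g x) = integral {X0 - r..X0 + r} ?g"
    by (rule set_borel_integral_eq_integral)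
  also have "\<dots> = of_real (pi * r\<^sup>2) / (2 * q ^ 3)"
    using semicircle_cube_integral[OF r0 q2 qpos] by (simp add: f_def integral_unique)
  finally have outer: "(LINT x:{X0 - r..X0 + r}|lborel. ?g x) = of_real (pi * r\<^sup>2) / (2 * q ^ 3)" .
  have "(LINT z|lborel. indicator R z *\<^sub>R f (fst z))
      = (LINT x|lborel. (LINT y|lborel. indicator R (x, y) *\<^sub>R f (fst (x, y))))"
    using int unfolding lborel_prod[symmetric] by (rule lborel_pair.integral_fst'[symmetric])
  also have "\<dots> = (LINT x|lborel. of_real \<kappa> * (indicator {X0 - r..X0 + r} x *\<^sub>R ?g x))"
    using inner by (simp add: mult_ac)
  also have "\<dots> = of_real \<kappa> * (LINT x:{X0 - r..X0 + r}|lborel. ?g x)"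
    unfolding set_lebesgue_integral_def by (rule integral_mult_right_zero)
  also have "\<dots> = of_real \<kappa> * (of_real (pi * r\<^sup>2) / (2 * q ^ 3))"
    by (simp only: outer)
  also have "\<dots> = of_real (pi * c * S\<^sup>2) / (of_real s * (of_real \<gamma> + \<i> * of_real \<mu>) ^ 3)"
  proof -
    have k: "\<kappa> * (pi * r\<^sup>2) / 2 * (sqrt a / s) ^ 3 = pi * c * S\<^sup>2 / s"
    proof -
      have "sqrt a * sqrt a ^ 3 = a\<^sup>2" using a0 by (simp add: eval_nat_numeral)
      have "\<kappa> * (pi * r\<^sup>2) / 2 * (sqrt a / s) ^ 3 = (c * pi * S\<^sup>2 / s) * ((sqrt a * sqrt a ^ 3) / a\<^sup>2)"
        unfolding \<kappa>_def r2 power_divide using a0 B0 pos by (simp add: power2_eq_square power3_eq_cube mult_ac)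
      also have "\<dots> = pi * c * S\<^sup>2 / s" using \<open>sqrt a * sqrt a ^ 3 = a\<^sup>2\<close> a0 by simp
      finally show ?thesis .
    qed
    have nz: "of_real \<gamma> + \<i> * of_real \<mu> \<noteq> (0 :: complex)"
      using pos steep by (auto simp: complex_eq_iff)
    have "of_real \<kappa> * (of_real (pi * r\<^sup>2) / (2 * q ^ 3))
        = of_real (\<kappa> * (pi * r\<^sup>2) / 2 * (sqrt a / s) ^ 3) / (of_real \<gamma> + \<i> * of_real \<mu>) ^ 3"
      using a0 pos nz by (simp add: q_def power_mult_distrib power_divide mult_ac)
    then show ?thesis unfolding k by simp
  qed
  finally show ?thesis by (simp add: f_def)
qed

section \<open>The constant of a circular cone\<close>

lemma circ_cone_scale:
  assumes "k > 0"
  shows "p + k *\<^sub>R v \<in> circ_cone p m \<theta> \<longleftrightarrow> p + v \<in> circ_cone p m \<theta>"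
  using assms by (simp add: circ_cone_def mult.assoc)

text \<open>A circular cone is invariant under dilations about its apex, so the cone over any of its plane
sections recovers the slab of the cone below the apex. Therefore the slices, and with them the
constant of the cone, do not depend on \<open>\<delta>\<close>.\<close>

lemma cone_over_circ_cone:
  assumes "\<delta> > 0"
  shows "cone_over p \<delta> (circ_cone p m \<theta> \<inter> {x. x \<bullet> \<omega> = p \<bullet> \<omega> - \<delta>})
       = circ_cone p m \<theta> \<inter> {x. p \<bullet> \<omega> - \<delta> < x \<bullet> \<omega> \<and> x \<bullet> \<omega> < p \<bullet> \<omega>}" (is "?L = ?R")
proof (intro equalityI subsetI)
  fix x assume "x \<in> ?L"
  then obtain s z where s: "0 < s" "s < \<delta>" and z: "z \<in> circ_cone p m \<theta>" "z \<bullet> \<omega> = p \<bullet> \<omega> - \<delta>"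
    and x: "x = p + (s / \<delta>) *\<^sub>R (z - p)"
    by (auto simp: cone_over_def)
  have "x \<bullet> \<omega> = p \<bullet> \<omega> - s"
    using assms z by (simp add: x inner_add_left inner_diff_left)
  moreover have "x \<in> circ_cone p m \<theta>"
    using circ_cone_scale[of "s / \<delta>" p "z - p" m \<theta>] s assms z by (simp add: x)
  ultimately show "x \<in> ?R" using s by simp
next
  fix x assume x: "x \<in> ?R"
  define s where "s = p \<bullet> \<omega> - x \<bullet> \<omega>"
  have s: "0 < s" "s < \<delta>" using x by (auto simp: s_def)
  define z where "z = p + (\<delta> / s) *\<^sub>R (x - p)"
  have "z \<in> circ_cone p m \<theta>"
    using circ_cone_scale[of "\<delta> / s" p "x - p" m \<theta>] s assms x by (simp add: z_def)
  moreover have "z \<bullet> \<omega> = p \<bullet> \<omega> - \<delta>"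
    using s by (simp add: z_def inner_add_left inner_diff_left) (simp add: s_def field_simps)
  moreover have "x = p + (s / \<delta>) *\<^sub>R (z - p)"
    using s assms by (simp add: z_def)
  ultimately show "x \<in> ?L"
    unfolding cone_over_def using s by (intro UN_I[of s] image_eqI[of _ _ z]) auto
qed

lemma cone_slice_circ_cone:
  assumes "0 < s" "s < \<delta>"
  shows "cone_slice p \<omega> \<delta> (circ_cone p m \<theta> \<inter> {x. x \<bullet> \<omega> = p \<bullet> \<omega> - \<delta>}) s
       = circ_cone p m \<theta> \<inter> {x. x \<bullet> \<omega> = p \<bullet> \<omega> - s}"
  using assms by (auto simp: cone_slice_def cone_over_circ_cone)

lemma open_circ_cone: "open (circ_cone p m \<theta>)"
  unfolding circ_cone_def by (intro open_Collect_less continuous_intros)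

text \<open>Coordinates are taken relative to the foot \<open>p - s \<omega>\<close> in the frame \<open>\<xi>, \<eta>\<close>; then \<open>(z - p) \<bullet> \<xi>\<close> is the first
coordinate and the slice is the section of the preceding part.\<close>

lemma circ_cone_slice_integral:
  fixes \<omega> n \<xi> p :: "real^3"
  assumes \<omega>: "norm \<omega> = 1" and n: "norm n = 1" and \<theta>: "0 < \<theta>" "\<theta> < pi / 2"
    and steep: "n \<bullet> \<omega> > sin \<theta>" and \<xi>: "\<xi> \<in> great_circle \<omega>" and s: "s > 0"
  shows "(LINT z:circ_cone p (- n) \<theta> \<inter> {x. x \<bullet> \<omega> = p \<bullet> \<omega> - s}|plane_area \<omega> (p \<bullet> \<omega> - s).
             1 / (of_real s - \<i> * of_real ((z - p) \<bullet> \<xi>)) ^ 3)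
       = of_real (pi * cos \<theta> * (sin \<theta>)\<^sup>2) / (of_real s * (of_real (n \<bullet> \<omega>) + \<i> * of_real (n \<bullet> \<xi>)) ^ 3)"
proof -
  have x1: "norm \<xi> = 1" "\<xi> \<bullet> \<omega> = 0" using \<xi> by (auto simp: great_circle_def inner_commute)
  obtain \<eta> where fr: "perp_orthonormal \<omega> \<xi> \<eta>"
    using perp_orthonormal_exists[OF \<omega> x1] by blast
  then have ip: "\<omega> \<bullet> \<omega> = 1" "\<xi> \<bullet> \<xi> = 1" "\<eta> \<bullet> \<eta> = 1" "\<xi> \<bullet> \<eta> = 0" "\<eta> \<bullet> \<xi> = 0" "\<xi> \<bullet> \<omega> = 0" "\<omega> \<bullet> \<xi> = 0"
      "\<eta> \<bullet> \<omega> = 0" "\<omega> \<bullet> \<eta> = 0"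
    using \<omega> by (auto simp: perp_orthonormal_def inner_commute dot_square_norm)
  have "(norm n)\<^sup>2 = (n \<bullet> \<xi>)\<^sup>2 + (n \<bullet> \<eta>)\<^sup>2 + (n \<bullet> \<omega>)\<^sup>2"
    using fr \<omega> by (intro orthonormal_norm_3) (auto simp: perp_orthonormal_def)
  then have unit: "(n \<bullet> \<omega>)\<^sup>2 + (n \<bullet> \<xi>)\<^sup>2 + (n \<bullet> \<eta>)\<^sup>2 = 1"
    using n by simp
  have nz: "of_real s - \<i> * of_real x \<noteq> (0 :: complex)" for x
    using s by (auto simp: complex_eq_iff)
  define p0 where "p0 = p - s *\<^sub>R \<omega>"
  have p0: "p0 \<bullet> \<omega> = p \<bullet> \<omega> - s" by (simp add: p0_def inner_diff_left ip)
  define A where "A = circ_cone p (- n) \<theta> \<inter> {x. x \<bullet> \<omega> = p \<bullet> \<omega> - s}"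
  have A: "A \<in> sets borel"
    unfolding A_def
    by (intro sets.Int borel_open borel_closed open_circ_cone closed_Collect_eq continuous_intros)
  have f: "(\<lambda>z. 1 / (of_real s - \<i> * of_real ((z - p) \<bullet> \<xi>)) ^ 3 :: complex) \<in> borel_measurable borel"
    by (intro borel_measurable_continuous_onI continuous_intros) (use nz in auto)
  have off: "(p0 + x *\<^sub>R \<xi> + y *\<^sub>R \<eta>) - p = x *\<^sub>R \<xi> + y *\<^sub>R \<eta> - s *\<^sub>R \<omega>" for x y
    by (simp add: p0_def)
  have off\<xi>: "((p0 + x *\<^sub>R \<xi> + y *\<^sub>R \<eta>) - p) \<bullet> \<xi> = x" for x y
    unfolding off by (simp add: inner_simps ip)
  have nrm: "norm ((p0 + x *\<^sub>R \<xi> + y *\<^sub>R \<eta>) - p) = sqrt (s\<^sup>2 + x\<^sup>2 + y\<^sup>2)" for x y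
    unfolding off norm_eq_sqrt_inner by (simp add: inner_simps ip power2_eq_square)
  have "p0 + x *\<^sub>R \<xi> + y *\<^sub>R \<eta> \<in> A \<longleftrightarrow>
      (n \<bullet> \<omega>) * s - (n \<bullet> \<xi>) * x - (n \<bullet> \<eta>) * y > cos \<theta> * sqrt (s\<^sup>2 + x\<^sup>2 + y\<^sup>2)" for x y
  proof -
    have "((p0 + x *\<^sub>R \<xi> + y *\<^sub>R \<eta>) - p) \<bullet> (- n) = (n \<bullet> \<omega>) * s - (n \<bullet> \<xi>) * x - (n \<bullet> \<eta>) * y"
      unfolding off by (simp add: inner_simps inner_commute)
    moreover have "(p0 + x *\<^sub>R \<xi> + y *\<^sub>R \<eta>) \<bullet> \<omega> = p \<bullet> \<omega> - s"
      using p0 by (simp add: inner_add_left ip)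
    ultimately show ?thesis
      unfolding A_def circ_cone_def Int_iff mem_Collect_eq nrm by (simp add: mult.commute)
  qed
  then have "(LINT z:A|plane_area \<omega> (p \<bullet> \<omega> - s). 1 / (of_real s - \<i> * of_real ((z - p) \<bullet> \<xi>)) ^ 3)
    = (LINT z|lborel. indicator {z :: real \<times> real. (n \<bullet> \<omega>) * s - (n \<bullet> \<xi>) * fst z - (n \<bullet> \<eta>) * snd z
          > cos \<theta> * sqrt (s\<^sup>2 + (fst z)\<^sup>2 + (snd z)\<^sup>2)} z *\<^sub>R (1 / (of_real s - \<i> * of_real (fst z)) ^ 3))"
    unfolding plane_area_integral[OF \<omega> fr p0 A f] off\<xi>
    by (intro Bochner_Integration.integral_cong refl) (simp add: indicator_def)
  also have "\<dots> = of_real (pi * cos \<theta> * (sin \<theta>)\<^sup>2) /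
      (of_real s * (of_real (n \<bullet> \<omega>) + \<i> * of_real (n \<bullet> \<xi>)) ^ 3)"
    using \<theta> steep s unit by (intro cone_section_integral) (auto simp: cos_gt_zero sin_gt_zero)
  finally show ?thesis unfolding A_def .
qed

lemma cone_const_circ_cone:
  fixes \<omega> n \<xi> p :: "real^3"
  assumes "norm \<omega> = 1" and "norm n = 1" and "0 < \<theta>" "\<theta> < pi / 2"
    and "n \<bullet> \<omega> > sin \<theta>" and "\<xi> \<in> great_circle \<omega>" and "\<delta> > 0"
  shows "cone_const p \<omega> \<delta> (circ_cone p (- n) \<theta> \<inter> {x. x \<bullet> \<omega> = p \<bullet> \<omega> - \<delta>}) \<xi>
       = of_real (2 * pi * cos \<theta> * (sin \<theta>)\<^sup>2) / (of_real (n \<bullet> \<omega>) + \<i> * of_real (n \<bullet> \<xi>)) ^ 3"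
    (is "_ = ?c")
proof -
  have val: "2 * of_real s * (LINT z:cone_slice p \<omega> \<delta> (circ_cone p (- n) \<theta> \<inter> {x. x \<bullet> \<omega> = p \<bullet> \<omega> - \<delta>}) s|
      plane_area \<omega> (p \<bullet> \<omega> - s). 1 / (of_real s - \<i> * of_real ((z - p) \<bullet> \<xi>)) ^ 3) = ?c"
    if "s \<in> {0<..<\<delta>}" for s
    using that assms by (simp add: cone_slice_circ_cone circ_cone_slice_integral)
  show ?thesis
    unfolding cone_const_def
  proof (rule the_equality)
    show "\<forall>s\<in>{0<..<\<delta>}. ?c = 2 * of_real s *
        (LINT z:cone_slice p \<omega> \<delta> (circ_cone p (- n) \<theta> \<inter> {x. x \<bullet> \<omega> = p \<bullet> \<omega> - \<delta>}) s|
          plane_area \<omega> (p \<bullet> \<omega> - s). 1 / (of_real s - \<i> * of_real ((z - p) \<bullet> \<xi>)) ^ 3)"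
      using val by metis
  next
    fix c
    assume "\<forall>s\<in>{0<..<\<delta>}. c = 2 * of_real s *
        (LINT z:cone_slice p \<omega> \<delta> (circ_cone p (- n) \<theta> \<inter> {x. x \<bullet> \<omega> = p \<bullet> \<omega> - \<delta>}) s|
          plane_area \<omega> (p \<bullet> \<omega> - s). 1 / (of_real s - \<i> * of_real ((z - p) \<bullet> \<xi>)) ^ 3)"
    \<comment> \<open>The description determines \<open>c\<close> because the range of \<open>s\<close> is nonempty.\<close>
    moreover have "\<delta> / 2 \<in> {0<..<\<delta>}" using \<open>\<delta> > 0\<close> by simp
    ultimately show "c = ?c" using val by metis
  qed
qed

section \<open>Regular directions and cone singularities\<close>

lemma support_set_singleton:
  assumes "regular_dir D \<omega>"
  shows "support_set D \<omega> = {support_point D \<omega>}"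
  using assms unfolding regular_dir_def support_point_def by (metis is_singleton_the_elem)

lemma support_point_props:
  assumes reg: "regular_dir D \<omega>" and bd: "bounded D"
  shows "support_point D \<omega> \<bullet> \<omega> = supp_fun D \<omega>"
    and "x \<in> closure D \<Longrightarrow> x \<noteq> support_point D \<omega> \<Longrightarrow> x \<bullet> \<omega> < supp_fun D \<omega>"
proof -
  show "support_point D \<omega> \<bullet> \<omega> = supp_fun D \<omega>"
    using support_set_singleton[OF reg] by (auto simp: support_set_def)
  assume x: "x \<in> closure D" "x \<noteq> support_point D \<omega>"
  have "bounded ((\<lambda>x. x \<bullet> \<omega>) ` D)"
    using bd by (rule bounded_linear_image) (rule bounded_linear_inner_left)
  then have "y \<bullet> \<omega> \<le> supp_fun D \<omega>" if "y \<in> D" for y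
    unfolding supp_fun_def using that by (intro cSUP_upper bounded_imp_bdd_above)
  then have "closure D \<subseteq> {y. y \<bullet> \<omega> \<le> supp_fun D \<omega>}"
    by (intro closure_minimal closed_Collect_le continuous_intros) auto
  then have "x \<bullet> \<omega> \<le> supp_fun D \<omega>" using x by auto
  moreover have "x \<bullet> \<omega> \<noteq> supp_fun D \<omega>"
    using support_set_singleton[OF reg] x by (auto simp: support_set_def)
  ultimately show "x \<bullet> \<omega> < supp_fun D \<omega>" by simp
qed

text \<open>Pushing \<open>v\<close> slightly towards the axis direction \<open>- n\<close> makes the cone inequality strict, because
\<open>cos \<theta> < 1\<close>. So \<open>p + v\<close> is a limit of points of the open cone.\<close>

lemma closed_cone_in_closure:
  fixes n p v :: "real^3"
  assumes loc: "D \<inter> ball p \<epsilon> = circ_cone p (- n) \<theta> \<inter> ball p \<epsilon>" and n: "norm n = 1"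
    and \<theta>: "cos \<theta> < 1" "cos \<theta> \<ge> 0" and v: "v \<bullet> (- n) \<ge> norm v * cos \<theta>" "norm v < \<epsilon>"
  shows "p + v \<in> closure D"
proof -
  have tend: "((\<lambda>e. p + (v - e *\<^sub>R n)) \<longlongrightarrow> p + (v - 0 *\<^sub>R n)) (at_right 0)"
    by (intro tendsto_intros)
  have "((\<lambda>e. norm (v - e *\<^sub>R n)) \<longlongrightarrow> norm (v - 0 *\<^sub>R n)) (at_right 0)"
    by (intro tendsto_intros)
  then have "eventually (\<lambda>e. norm (v - e *\<^sub>R n) < \<epsilon>) (at_right 0)"
    using v(2) by (intro order_tendstoD) auto
  moreover have "eventually (\<lambda>e::real. e > 0) (at_right 0)"
    by (rule eventually_at_right_less)
  ultimately have "eventually (\<lambda>e. p + (v - e *\<^sub>R n) \<in> closure D) (at_right 0)"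
  proof eventually_elim
    case (elim e)
    have "norm (v - e *\<^sub>R n) * cos \<theta> \<le> (norm v + e) * cos \<theta>"
      using norm_triangle_ineq4[of v "e *\<^sub>R n"] n elim \<theta> by (intro mult_right_mono) auto
    also have "\<dots> < norm v * cos \<theta> + e"
      using elim \<theta> by (simp add: algebra_simps)
    also have "\<dots> \<le> (v - e *\<^sub>R n) \<bullet> (- n)"
      using v(1) n by (simp add: inner_diff_left dot_square_norm)
    finally have "p + (v - e *\<^sub>R n) \<in> circ_cone p (- n) \<theta> \<inter> ball p \<epsilon>"
      using elim by (simp add: circ_cone_def dist_norm norm_minus_commute)
    then show ?case using loc closure_subset[of D] by blast
  qed
  then show ?thesis
    using Lim_in_closed_set[OF closed_closure _ _ tend] by simp
qed

text \<open>All nonzero vectors of the closed cone point strictly below the supporting plane, by uniqueness of the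
support point. Among them, the generator \<open>v\<close> in the plane of \<open>n\<close> and \<open>\<omega>\<close> on the side of \<open>\<omega>\<close> is the
highest, and \<open>v \<bullet> \<omega> < 0\<close> says \<open>sin \<theta> \<surd>(1 - \<gamma>\<^sup>2) < \<gamma> cos \<theta>\<close>, that is, \<open>sin \<theta> < \<gamma>\<close>. The open
cone would only give the weak inequality.\<close>

lemma regular_cone_is_steep:
  assumes reg: "regular_dir D \<omega>" and bd: "bounded D" and cone: "cone_singularity D (support_point D \<omega>) n \<theta>"
    and \<omega>: "norm \<omega> = 1" and \<gamma>0: "n \<bullet> \<omega> > 0"
  shows "n \<bullet> \<omega> > sin \<theta>"
proof -
  define p where "p = support_point D \<omega>"
  define \<gamma> where "\<gamma> = n \<bullet> \<omega>"
  obtain \<epsilon> where "\<epsilon> > 0" and loc: "D \<inter> ball p \<epsilon> = circ_cone p (- n) \<theta> \<inter> ball p \<epsilon>"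
    and n: "norm n = 1" and \<theta>: "0 < \<theta>" "\<theta> < pi / 2"
    using cone by (auto simp: cone_singularity_def p_def)
  have c: "0 < cos \<theta>" "cos \<theta> < 1" and S: "0 < sin \<theta>" "sin \<theta> < 1"
    using \<theta> cos_gt_zero[of \<theta>] cos_monotone_0_pi[of 0 \<theta>] sin_gt_zero[of \<theta>]
      sin_monotone_2pi[of \<theta> "pi / 2"] by auto
  have \<gamma>1: "\<gamma> \<le> 1" using norm_cauchy_schwarz[of n \<omega>] n \<omega> by (simp add: \<gamma>_def)
  have neg: "v \<bullet> \<omega> < 0" if v: "v \<bullet> (- n) \<ge> norm v * cos \<theta>" "v \<noteq> 0" for v
  proof -
    define k where "k = \<epsilon> / (2 * norm v)"
    have k: "k > 0" using \<open>\<epsilon> > 0\<close> v by (simp add: k_def)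
    have "k * (norm v * cos \<theta>) \<le> k * (v \<bullet> (- n))"
      using v(1) k by (intro mult_left_mono) auto
    then have "p + k *\<^sub>R v \<in> closure D"
      using k c v(2) \<open>\<epsilon> > 0\<close>
      by (intro closed_cone_in_closure[OF loc n]) (auto simp: k_def)
    then have "(p + k *\<^sub>R v) \<bullet> \<omega> < p \<bullet> \<omega>"
      using support_point_props[OF reg bd] k v(2) by (auto simp: p_def)
    then show ?thesis using k by (simp add: inner_add_left mult_less_0_iff)
  qed
  show ?thesis
  proof (cases "\<gamma> = 1")
    case True
    then show ?thesis using S by (simp add: \<gamma>_def)
  next
    case False
    define \<sigma> where "\<sigma> = sqrt (1 - \<gamma>\<^sup>2)"
    have "\<gamma>\<^sup>2 < 1" using \<gamma>1 False \<gamma>0 by (simp add: abs_square_less_1 \<gamma>_def)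
    then have \<sigma>: "\<sigma> > 0" "\<sigma>\<^sup>2 = 1 - \<gamma>\<^sup>2" by (simp_all add: \<sigma>_def)
    have ip: "n \<bullet> n = 1" "\<omega> \<bullet> \<omega> = 1" "n \<bullet> \<omega> = \<gamma>" "\<omega> \<bullet> n = \<gamma>"
      using n \<omega> by (simp_all add: dot_square_norm \<gamma>_def inner_commute)
    define m where "m = (1 / \<sigma>) *\<^sub>R (\<omega> - \<gamma> *\<^sub>R n)"
    have m: "m \<bullet> n = 0" "n \<bullet> m = 0" "m \<bullet> \<omega> = \<sigma>"
      using \<sigma> by (simp_all add: m_def inner_simps ip power2_eq_square)
        (simp add: field_simps power2_eq_square)
    have "m \<bullet> m = (m \<bullet> \<omega> - \<gamma> * (m \<bullet> n)) / \<sigma>"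
      by (subst (2) m_def) (simp add: inner_simps)
    then have mm: "m \<bullet> m = 1" using m \<sigma> by simp
    define v where "v = sin \<theta> *\<^sub>R m - cos \<theta> *\<^sub>R n"
    have "v \<bullet> v = (sin \<theta>)\<^sup>2 + (cos \<theta>)\<^sup>2"
      by (simp add: v_def inner_simps m mm ip power2_eq_square del: sin_cos_squared_add)
    then have "v \<bullet> v = 1" by simp
    then have "norm v = 1" "v \<noteq> 0" by (auto simp: norm_eq_sqrt_inner)
    moreover have "v \<bullet> (- n) = cos \<theta>" by (simp add: v_def inner_simps m ip)
    ultimately have "v \<bullet> \<omega> < 0" by (intro neg) auto
    then have "sin \<theta> * \<sigma> < cos \<theta> * \<gamma>" by (simp add: v_def inner_simps m ip)
    then have "(sin \<theta> * \<sigma>)\<^sup>2 < (cos \<theta> * \<gamma>)\<^sup>2"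
      using S \<sigma> by (intro power_strict_mono) auto
    then have "(sin \<theta>)\<^sup>2 < \<gamma>\<^sup>2"
      by (simp add: power_mult_distrib \<sigma> cos_squared_eq algebra_simps)
    then show ?thesis
      using \<gamma>0 unfolding \<gamma>_def by (auto elim: power2_less_imp_less)
  qed
qed

text \<open>Near \<open>p\<close> the domain is the cone, so it suffices that both thin slabs lie in the ball of
radius \<open>\<epsilon>\<close>. For the cone this is the estimate \<open>thin\<close>: with \<open>\<sigma>\<close> the norm of the component of \<open>n\<close>
orthogonal to \<open>\<omega>\<close>, steepness gives \<open>\<sigma> < cos \<theta>\<close> and bounds \<open>\<bar>x - p\<bar>\<close> by the depth of \<open>x\<close> below
the supporting plane. For \<open>D\<close> it follows by compactness, since \<open>p\<close> is the only point of the
closure at maximal height.\<close>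

lemma admissible_exists:
  assumes reg: "regular_dir D \<omega>" and bd: "bounded D" and cone: "cone_singularity D (support_point D \<omega>) n \<theta>"
    and \<omega>: "norm \<omega> = 1" and steep: "n \<bullet> \<omega> > sin \<theta>"
  shows "\<exists>\<delta>. admissible D \<omega> n \<theta> \<delta>"
proof -
  define p where "p = support_point D \<omega>"
  define \<gamma> where "\<gamma> = n \<bullet> \<omega>"
  define \<sigma> where "\<sigma> = norm (n - \<gamma> *\<^sub>R \<omega>)"
  obtain \<epsilon> where "\<epsilon> > 0" and loc: "D \<inter> ball p \<epsilon> = circ_cone p (- n) \<theta> \<inter> ball p \<epsilon>"
    and n: "norm n = 1" and \<theta>: "0 < \<theta>" "\<theta> < pi / 2"
    using cone by (auto simp: cone_singularity_def p_def)
  have c: "0 < cos \<theta>" and S: "0 < sin \<theta>"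
    using \<theta> cos_gt_zero[of \<theta>] sin_gt_zero[of \<theta>] by auto
  have \<gamma>S: "\<gamma> > sin \<theta>" "\<gamma> > 0" using steep S by (simp_all add: \<gamma>_def)
  have ip: "n \<bullet> n = 1" "\<omega> \<bullet> \<omega> = 1" "n \<bullet> \<omega> = \<gamma>" "\<omega> \<bullet> n = \<gamma>"
    using n \<omega> by (simp_all add: dot_square_norm \<gamma>_def inner_commute)
  have "\<sigma>\<^sup>2 = 1 - \<gamma>\<^sup>2"
    unfolding \<sigma>_def power2_norm_eq_inner by (simp add: inner_simps ip power2_eq_square)
  moreover have "(sin \<theta>)\<^sup>2 < \<gamma>\<^sup>2" using \<gamma>S S by (intro power_strict_mono) auto
  ultimately have "\<sigma>\<^sup>2 < (cos \<theta>)\<^sup>2" by (simp add: cos_squared_eq)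
  then have \<sigma>: "\<sigma> < cos \<theta>" by (rule power2_less_imp_less) (use c in simp)
  have h: "supp_fun D \<omega> = p \<bullet> \<omega>" using support_point_props(1)[OF reg bd] by (simp add: p_def)
  have thin: "(cos \<theta> - \<sigma>) * norm (x - p) < \<gamma> * (p \<bullet> \<omega> - x \<bullet> \<omega>)" if "x \<in> circ_cone p (- n) \<theta>" for x
  proof -
    let ?v = "x - p"
    have "norm ?v * cos \<theta> < - (?v \<bullet> n)" using that by (simp add: circ_cone_def)
    also have "- (?v \<bullet> n) = \<gamma> * (- (?v \<bullet> \<omega>)) - ?v \<bullet> (n - \<gamma> *\<^sub>R \<omega>)"
      by (simp add: inner_simps algebra_simps)
    also have "\<dots> \<le> \<gamma> * (- (?v \<bullet> \<omega>)) + norm ?v * \<sigma>"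
      using norm_cauchy_schwarz[of "- ?v" "n - \<gamma> *\<^sub>R \<omega>"] by (simp add: \<sigma>_def norm_minus_commute inner_diff_left)
    finally show ?thesis by (simp add: inner_diff_left algebra_simps)
  qed
  obtain \<beta> where \<beta>: "\<beta> > 0" and far: "\<And>x. x \<in> closure D - ball p \<epsilon> \<Longrightarrow> x \<bullet> \<omega> \<le> p \<bullet> \<omega> - \<beta>"
  proof (cases "closure D - ball p \<epsilon> = {}")
    case True
    then show thesis by (intro that[of 1]) auto
  next
    case False
    have cont: "continuous_on (closure D - ball p \<epsilon>) (\<lambda>x. x \<bullet> \<omega>)"
      by (intro continuous_intros)
    have comp: "compact (closure D - ball p \<epsilon>)"
      using bd by (intro compact_diff) (auto simp: compact_closure)
    obtain y where y: "y \<in> closure D - ball p \<epsilon>" "\<And>x. x \<in> closure D - ball p \<epsilon> \<Longrightarrow> x \<bullet> \<omega> \<le> y \<bullet> \<omega>"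
      using continuous_attains_sup[OF comp False cont] by blast
    then have "y \<noteq> p" using \<open>\<epsilon> > 0\<close> by auto
    then have "y \<bullet> \<omega> < p \<bullet> \<omega>"
      using support_point_props(2)[OF reg bd, of y] y(1) h by (simp add: p_def)
    then show thesis using y by (intro that[of "p \<bullet> \<omega> - y \<bullet> \<omega>"]) auto
  qed
  define \<delta> where "\<delta> = min \<beta> ((cos \<theta> - \<sigma>) * \<epsilon> / \<gamma>)"
  have \<delta>: "\<delta> > 0" "\<delta> \<le> \<beta>" "\<gamma> * \<delta> \<le> (cos \<theta> - \<sigma>) * \<epsilon>"
    using \<beta> \<sigma> \<gamma>S \<open>\<epsilon> > 0\<close> by (auto simp: \<delta>_def min_def field_simps)
  have "D \<inter> {x. p \<bullet> \<omega> - \<delta> < x \<bullet> \<omega> \<and> x \<bullet> \<omega> < p \<bullet> \<omega>}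
      = circ_cone p (- n) \<theta> \<inter> {x. p \<bullet> \<omega> - \<delta> < x \<bullet> \<omega> \<and> x \<bullet> \<omega> < p \<bullet> \<omega>}"
  proof -
    have "x \<in> ball p \<epsilon>" if "x \<in> D" "p \<bullet> \<omega> - \<delta> < x \<bullet> \<omega>" for x
    proof (rule ccontr)
      assume "x \<notin> ball p \<epsilon>"
      then have "x \<bullet> \<omega> \<le> p \<bullet> \<omega> - \<beta>" using far[of x] that closure_subset[of D] by blast
      then show False using that \<delta> by linarith
    qed
    moreover have "x \<in> ball p \<epsilon>" if "x \<in> circ_cone p (- n) \<theta>" "p \<bullet> \<omega> - \<delta> < x \<bullet> \<omega>" for x
    proof -
      have "(cos \<theta> - \<sigma>) * norm (x - p) < \<gamma> * (p \<bullet> \<omega> - x \<bullet> \<omega>)" by (rule thin[OF that(1)])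
      also have "\<dots> \<le> \<gamma> * \<delta>" using that(2) \<gamma>S by (intro mult_left_mono) auto
      also note \<delta>(3)
      finally have "norm (x - p) < \<epsilon>" using \<sigma> by simp
      then show ?thesis by (simp add: dist_norm norm_minus_commute)
    qed
    ultimately show ?thesis using loc by blast
  qed
  then have "admissible D \<omega> n \<theta> \<delta>"
    using \<delta>(1) by (simp add: admissible_def cone_base_def h p_def[symmetric] cone_over_circ_cone)
  then show ?thesis ..
qed

text \<open>All admissible heights lead to the same constant, and by \<open>admissible_exists\<close> there is one, so the
definite description has a value.\<close>

lemma indicator_I_circ_cone:
  assumes reg: "regular_dir D \<omega>" and bd: "bounded D" and cone: "cone_singularity D (support_point D \<omega>) n \<theta>"
    and \<omega>: "norm \<omega> = 1" and steep: "n \<bullet> \<omega> > sin \<theta>" and \<xi>: "\<xi> \<in> great_circle \<omega>"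
  shows "indicator_I D \<rho>' n \<theta> \<omega> \<xi> = \<rho>' (support_point D \<omega>) *
    (of_real (2 * pi * cos \<theta> * (sin \<theta>)\<^sup>2) / (of_real (n \<bullet> \<omega>) + \<i> * of_real (n \<bullet> \<xi>)) ^ 3)" (is "_ = ?c")
proof -
  have h: "supp_fun D \<omega> = support_point D \<omega> \<bullet> \<omega>" using support_point_props(1)[OF reg bd] by simp
  have val: "\<rho>' (support_point D \<omega>) * cone_const (support_point D \<omega>) \<omega> \<delta> (cone_base D \<omega> n \<theta> \<delta>) \<xi> = ?c"
    if "admissible D \<omega> n \<theta> \<delta>" for \<delta>
    using that cone \<omega> steep \<xi>
    by (simp add: cone_base_def h admissible_def cone_singularity_def cone_const_circ_cone)
  obtain \<delta> where "admissible D \<omega> n \<theta> \<delta>"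
    using admissible_exists[OF reg bd cone \<omega> steep] by blast
  then show ?thesis
    unfolding indicator_I_def using val by (intro the_equality) metis+
qed

text \<open>In a frame of the plane orthogonal to \<open>\<omega>\<close>, \<open>n \<bullet> \<xi>\<close> is \<open>\<sigma> cos (t - \<phi>)\<close>, where \<open>\<sigma>, \<phi>\<close> are polar
coordinates of the projection of \<open>n\<close>. Since \<open>\<gamma>\<^sup>2 + \<sigma>\<^sup>2 = 1\<close>, the parameters \<open>w = \<gamma>\<close> and
\<open>b = \<i> \<sigma>\<close> have \<open>w\<^sup>2 - b\<^sup>2 = 1\<close>, and the integral is that of the first part with \<open>q = 1\<close>.\<close>

lemma great_circle_cube_integral:
  fixes \<omega> n :: "real^3"
  assumes \<omega>: "norm \<omega> = 1" and n: "norm n = 1" and \<gamma>0: "n \<bullet> \<omega> > 0"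
  shows "(LINT \<xi>:great_circle \<omega>|arc_length \<omega>. 1 / (of_real (n \<bullet> \<omega>) + \<i> * of_real (n \<bullet> \<xi>)) ^ 3)
       = of_real (pi * (3 * (n \<bullet> \<omega>)\<^sup>2 - 1))"
    and "\<exists>\<xi>\<in>great_circle \<omega>. n \<bullet> \<xi> = 0"
proof -
  define \<gamma> where "\<gamma> = n \<bullet> \<omega>"
  obtain a b where fr: "perp_frame \<omega> = (a, b)" by (cases "perp_frame \<omega>")
  have ab: "perp_orthonormal \<omega> a b"
    using perp_frame_orthonormal[OF \<omega>] by (simp add: fr)
  then have ip: "\<omega> \<bullet> \<omega> = 1" "a \<bullet> a = 1" "b \<bullet> b = 1" "a \<bullet> b = 0" "b \<bullet> a = 0" "a \<bullet> \<omega> = 0" "\<omega> \<bullet> a = 0"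
      "b \<bullet> \<omega> = 0" "\<omega> \<bullet> b = 0"
    using \<omega> by (auto simp: perp_orthonormal_def inner_commute dot_square_norm)
  have "(norm n)\<^sup>2 = (n \<bullet> a)\<^sup>2 + (n \<bullet> b)\<^sup>2 + (n \<bullet> \<omega>)\<^sup>2"
    using ab \<omega> by (intro orthonormal_norm_3) (auto simp: perp_orthonormal_def)
  then have unit: "(n \<bullet> a)\<^sup>2 + (n \<bullet> b)\<^sup>2 = 1 - \<gamma>\<^sup>2"
    using n by (simp add: \<gamma>_def)
  define z where "z = Complex (n \<bullet> a) (n \<bullet> b)"
  define \<sigma> where "\<sigma> = cmod z"
  define \<phi> where "\<phi> = Arg z"
  have "rcis \<sigma> \<phi> = z" by (simp add: \<sigma>_def \<phi>_def rcis_cmod_Arg)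
  then have na: "n \<bullet> a = \<sigma> * cos \<phi>" and nb: "n \<bullet> b = \<sigma> * sin \<phi>"
    by (auto simp: z_def complex_eq_iff)
  have \<sigma>2: "\<sigma>\<^sup>2 = 1 - \<gamma>\<^sup>2" using unit by (simp add: \<sigma>_def z_def cmod_power2)
  define curve where "curve = (\<lambda>t. cos t *\<^sub>R a + sin t *\<^sub>R b)"
  have curve: "curve t \<in> great_circle \<omega>" for t
    unfolding great_circle_def curve_def norm_eq_sqrt_inner
    by (simp add: inner_simps ip power2_eq_square[symmetric])
  have ncurve: "n \<bullet> curve t = \<sigma> * cos (t - \<phi>)" for t
    by (simp add: curve_def inner_simps na nb cos_diff algebra_simps)
  have "n \<bullet> curve (\<phi> + pi / 2) = 0" unfolding ncurve by simp
  then show "\<exists>\<xi>\<in>great_circle \<omega>. n \<bullet> \<xi> = 0" using curve by blast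
  define f where "f = (\<lambda>\<xi>. 1 / (of_real \<gamma> + \<i> * of_real (n \<bullet> \<xi>)) ^ 3 :: complex)"
  have nz: "of_real \<gamma> + \<i> * of_real x \<noteq> (0 :: complex)" for x
    using \<gamma>0 by (auto simp: complex_eq_iff \<gamma>_def)
  have nz': "of_real \<gamma> + \<i> * (of_real \<sigma> * of_real x) \<noteq> (0 :: complex)" for x
    using nz[of "\<sigma> * x"] by simp
  have [measurable]: "f \<in> borel_measurable borel"
    unfolding f_def by (intro borel_measurable_continuous_onI continuous_intros) (use nz in auto)
  have [measurable]: "curve \<in> borel_measurable borel"
    unfolding curve_def by (intro borel_measurable_continuous_onI continuous_intros)
  have "great_circle \<omega> = {\<xi>. norm \<xi> = 1} \<inter> {\<xi>. \<omega> \<bullet> \<xi> = 0}" by (auto simp: great_circle_def)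
  moreover have "closed \<dots>" by (intro closed_Int closed_Collect_eq continuous_intros)
  ultimately have [measurable]: "great_circle \<omega> \<in> sets borel" by (metis borel_closed)
  have hi: "((\<lambda>t. f (curve t)) has_integral of_real (pi * (3 * \<gamma>\<^sup>2 - 1))) {0..2 * pi}"
  proof -
    have "1\<^sup>2 = (of_real \<gamma>)\<^sup>2 - (\<i> * of_real \<sigma> :: complex)\<^sup>2"
      using \<sigma>2 by (simp add: power_mult_distrib) (simp add: of_real_power[symmetric] del: of_real_power)
    then have "((\<lambda>t. 1 / (of_real \<gamma> + \<i> * of_real \<sigma> * of_real (cos (t - \<phi>))) ^ 3) has_integral
        of_real pi * (3 * (of_real \<gamma>)\<^sup>2 - 1\<^sup>2) / 1 ^ 5) {0..2 * pi}"
      using \<gamma>0 by (intro trig_linear_cube_integral) (simp_all add: \<gamma>_def)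
    then show ?thesis by (simp add: f_def ncurve mult.assoc)
  qed
  have "set_integrable lborel {0..2 * pi} (\<lambda>t. f (curve t))"
    unfolding f_def ncurve
    by (intro borel_integrable_atLeastAtMost' continuous_intros) (use nz' in auto)
  then have "(LINT t:{0..2 * pi}|lborel. f (curve t)) = of_real (pi * (3 * \<gamma>\<^sup>2 - 1))"
    using set_borel_integral_eq_integral(2) integral_unique[OF hi] by metis
  moreover have "(LINT \<xi>:great_circle \<omega>|arc_length \<omega>. f \<xi>) = (LINT t:{0..<2 * pi}|lborel. f (curve t))"
  proof -
    have "(LINT \<xi>:great_circle \<omega>|arc_length \<omega>. f \<xi>)
        = (LINT t|restrict_space lborel {0..<2 * pi}. indicator (great_circle \<omega>) (curve t) *\<^sub>R f (curve t))"
      unfolding set_lebesgue_integral_def arc_length_def fr prod.case curve_def[symmetric]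
      by (subst integral_distr) (auto intro: measurable_restrict_space1)
    also have "\<dots> = (LINT t:{0..<2 * pi}|lborel. f (curve t))"
      unfolding set_lebesgue_integral_def by (subst integral_restrict_space) (auto simp: curve)
    finally show ?thesis .
  qed
  moreover have "(LINT t:{0..<2 * pi}|lborel. f (curve t)) = (LINT t:{0..2 * pi}|lborel. f (curve t))"
    unfolding set_lebesgue_integral_def
  proof (rule integral_cong_AE)
    have "AE t in lborel. t \<noteq> 2 * pi" by (rule AE_lborel_singleton)
    then show "AE t in lborel. indicator {0..<2 * pi} t *\<^sub>R f (curve t) = indicator {0..2 * pi} t *\<^sub>R f (curve t)"
      by eventually_elim (auto simp: indicator_def)
  qed auto
  ultimately show "(LINT \<xi>:great_circle \<omega>|arc_length \<omega>. 1 / (of_real (n \<bullet> \<omega>) + \<i> * of_real (n \<bullet> \<xi>)) ^ 3)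
       = of_real (pi * (3 * (n \<bullet> \<omega>)\<^sup>2 - 1))"
    by (simp add: f_def \<gamma>_def)
qed

section \<open>The inversion formulae\<close>

lemma quintic_strict_mono:
  fixes x y :: real
  assumes "1 / sqrt 3 < x" "x < y"
  shows "x ^ 3 * (3 * x\<^sup>2 - 1) < y ^ 3 * (3 * y\<^sup>2 - 1)"
proof -
  have "0 < 1 / sqrt (3 :: real)" by simp
  then have x0: "0 < x" using assms(1) by (rule less_trans)
  have "(1 / sqrt 3)\<^sup>2 < x\<^sup>2" using assms by (intro power_strict_mono) auto
  then have x: "3 * x\<^sup>2 - 1 > 0" by (simp add: power_divide)
  have "x\<^sup>2 < y\<^sup>2" "x ^ 3 < y ^ 3" using assms x0 by (auto intro!: power_strict_mono)
  then show ?thesis using x assms x0 by (intro mult_strict_mono) auto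
qed

theorem corollary1p5:
  fixes \<Omega> D :: "(real^3) set" and k :: real
    and \<rho> \<rho>' u :: "real^3 \<Rightarrow> complex"
    and \<omega> n :: "real^3" and \<theta> :: real
  assumes "open \<Omega>" and "connected \<Omega>" and "bounded \<Omega>" and "C2_boundary \<Omega>"
    and "k \<ge> 0"
    and "open D" and "D \<noteq> {}" and "closure D \<subseteq> \<Omega>"
    and "L2_on D \<rho>"
    and "H1_solution \<Omega> k (source \<rho> D) u"
    and "norm \<omega> = 1" and "regular_dir D \<omega>"
    and "cone_singularity D (support_point D \<omega>) n \<theta>"
    and "active_with \<rho> D (support_point D \<omega>) \<rho>'"
    and "n \<bullet> \<omega> > 1 / sqrt 3"
  shows "let I = indicator_I D \<rho>' n \<theta> \<omega>;
             J = (LINT \<xi>:great_circle \<omega>|arc_length \<omega>. I \<xi>);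
             M = (GREATEST m. m \<in> (\<lambda>\<xi>. cmod (I \<xi>)) ` great_circle \<omega>);
             \<gamma> = n \<bullet> \<omega>;
             T = (\<lambda>\<xi>. J / (of_real (pi * (3 * \<gamma>\<^sup>2 - 1)) * I \<xi>))
         in {g \<in> {1 / sqrt 3 <.. 1}. g ^ 3 * (3 * g\<^sup>2 - 1) = cmod J / (pi * M)} = {\<gamma>} \<and>
            (\<forall>\<xi>\<in>great_circle \<omega>. let \<mu> = n \<bullet> \<xi> in
               \<mu>\<^sup>2 = (\<gamma> ^ 3 - Re (T \<xi>)) / (3 * \<gamma>) \<and>
               \<mu> = Im (T \<xi>) / (3 * \<gamma>\<^sup>2 - \<mu>\<^sup>2))"
proof -
  define I where "I = indicator_I D \<rho>' n \<theta> \<omega>"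
  define J where "J = (LINT \<xi>:great_circle \<omega>|arc_length \<omega>. I \<xi>)"
  define M where "M = (GREATEST m. m \<in> (\<lambda>\<xi>. cmod (I \<xi>)) ` great_circle \<omega>)"
  define \<gamma> where "\<gamma> = n \<bullet> \<omega>"
  define T where "T = (\<lambda>\<xi>. J / (of_real (pi * (3 * \<gamma>\<^sup>2 - 1)) * I \<xi>))"
  define K where "K = \<rho>' (support_point D \<omega>) * of_real (2 * pi * cos \<theta> * (sin \<theta>)\<^sup>2)"
  have bd: "bounded D"
    using assms(3,8) closure_subset[of D] by (meson bounded_subset)
  have n: "norm n = 1" and \<theta>: "0 < \<theta>" "\<theta> < pi / 2"
    using assms(13) by (auto simp: cone_singularity_def)
  have \<gamma>3: "1 / sqrt 3 < \<gamma>" using assms(15) by (simp add: \<gamma>_def)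
  have "0 < 1 / sqrt (3 :: real)" by simp
  then have \<gamma>0: "\<gamma> > 0" using \<gamma>3 by (rule less_trans)
  have \<gamma>1: "\<gamma> \<le> 1"
    using norm_cauchy_schwarz[of n \<omega>] n assms(11) by (simp add: \<gamma>_def)
  have steep: "n \<bullet> \<omega> > sin \<theta>"
    using regular_cone_is_steep[OF assms(12) bd assms(13,11)] \<gamma>0 by (simp add: \<gamma>_def)
  have K0: "K \<noteq> 0"
    using assms(14) \<theta> cos_gt_zero[of \<theta>] sin_gt_zero[of \<theta>] by (auto simp: K_def active_with_def)
  have I: "I \<xi> = K / (of_real \<gamma> + \<i> * of_real (n \<bullet> \<xi>)) ^ 3" if "\<xi> \<in> great_circle \<omega>" for \<xi>
    using indicator_I_circ_cone[OF assms(12) bd assms(13,11) steep that]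
    by (simp add: I_def K_def \<gamma>_def)
  have "(1 / sqrt 3)\<^sup>2 < \<gamma>\<^sup>2" using \<gamma>3 by (intro power_strict_mono) auto
  then have q0: "3 * \<gamma>\<^sup>2 - 1 > 0" by (simp add: power_divide)
  have gc: "great_circle \<omega> \<in> sets (arc_length \<omega>)"
  proof -
    have "great_circle \<omega> = {\<xi>. norm \<xi> = 1} \<inter> {\<xi>. \<omega> \<bullet> \<xi> = 0}" by (auto simp: great_circle_def)
    moreover have "closed \<dots>" by (intro closed_Int closed_Collect_eq continuous_intros)
    ultimately show ?thesis by (simp add: arc_length_def case_prod_beta')
  qed
  have "J = (LINT \<xi>:great_circle \<omega>|arc_length \<omega>. K * (1 / (of_real \<gamma> + \<i> * of_real (n \<bullet> \<xi>)) ^ 3))"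
    unfolding J_def using gc I by (intro set_lebesgue_integral_cong) auto
  also have "\<dots> = K * of_real (pi * (3 * \<gamma>\<^sup>2 - 1))"
    using great_circle_cube_integral(1)[OF assms(11) n \<gamma>0[unfolded \<gamma>_def]]
    by (simp only: set_integral_mult_right \<gamma>_def)
  finally have J: "J = K * of_real (pi * (3 * \<gamma>\<^sup>2 - 1))" .
  have nI: "cmod (I \<xi>) = cmod K / (sqrt (\<gamma>\<^sup>2 + (n \<bullet> \<xi>)\<^sup>2)) ^ 3" if "\<xi> \<in> great_circle \<omega>" for \<xi>
  proof -
    have "cmod (of_real \<gamma> + \<i> * of_real (n \<bullet> \<xi>)) = sqrt (\<gamma>\<^sup>2 + (n \<bullet> \<xi>)\<^sup>2)"
      by (simp add: cmod_def)
    then show ?thesis by (simp add: I[OF that] norm_divide norm_power)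
  qed
  have M: "M = cmod K / \<gamma> ^ 3"
    unfolding M_def
  proof (rule Greatest_equality)
    obtain \<xi> where "\<xi> \<in> great_circle \<omega>" "n \<bullet> \<xi> = 0"
      using great_circle_cube_integral(2)[OF assms(11) n \<gamma>0[unfolded \<gamma>_def]] by blast
    then show "cmod K / \<gamma> ^ 3 \<in> (\<lambda>\<xi>. cmod (I \<xi>)) ` great_circle \<omega>"
      using nI[of \<xi>] \<gamma>0 by (intro image_eqI[of _ _ \<xi>]) auto
  next
    fix m assume "m \<in> (\<lambda>\<xi>. cmod (I \<xi>)) ` great_circle \<omega>"
    then obtain \<xi> where \<xi>: "\<xi> \<in> great_circle \<omega>" "m = cmod (I \<xi>)" by auto
    have "\<gamma> \<le> sqrt (\<gamma>\<^sup>2 + (n \<bullet> \<xi>)\<^sup>2)" using \<gamma>0 by (intro real_le_rsqrt) simp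
    then have "\<gamma> ^ 3 \<le> sqrt (\<gamma>\<^sup>2 + (n \<bullet> \<xi>)\<^sup>2) ^ 3" using \<gamma>0 by (intro power_mono) auto
    then show "m \<le> cmod K / \<gamma> ^ 3"
      using \<gamma>0 unfolding \<xi>(2) nI[OF \<xi>(1)]
      by (intro divide_left_mono) (auto simp: add_pos_nonneg)
  qed
  have ratio: "cmod J / (pi * M) = \<gamma> ^ 3 * (3 * \<gamma>\<^sup>2 - 1)"
  proof -
    have "cmod (of_real (pi * (3 * \<gamma>\<^sup>2 - 1))) = pi * (3 * \<gamma>\<^sup>2 - 1)"
      using q0 unfolding norm_of_real by simp
    then have "cmod J = cmod K * (pi * (3 * \<gamma>\<^sup>2 - 1))" by (simp only: J norm_mult)
    then show ?thesis using K0 \<gamma>0 by (simp add: M)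
  qed
  have "{g \<in> {1 / sqrt 3 <.. 1}. g ^ 3 * (3 * g\<^sup>2 - 1) = cmod J / (pi * M)} = {\<gamma>}"
  proof (intro equalityI subsetI)
    fix g assume "g \<in> {g \<in> {1 / sqrt 3 <.. 1}. g ^ 3 * (3 * g\<^sup>2 - 1) = cmod J / (pi * M)}"
    then have g: "1 / sqrt 3 < g" "g ^ 3 * (3 * g\<^sup>2 - 1) = \<gamma> ^ 3 * (3 * \<gamma>\<^sup>2 - 1)"
      by (auto simp: ratio)
    then have "g = \<gamma>"
      using quintic_strict_mono[of g \<gamma>] quintic_strict_mono[of \<gamma> g] \<gamma>3 by (cases g \<gamma> rule: linorder_cases) auto
    then show "g \<in> {\<gamma>}" by simp
  qed (use \<gamma>3 \<gamma>1 ratio in auto)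
  moreover have "(n \<bullet> \<xi>)\<^sup>2 = (\<gamma> ^ 3 - Re (T \<xi>)) / (3 * \<gamma>) \<and>
      n \<bullet> \<xi> = Im (T \<xi>) / (3 * \<gamma>\<^sup>2 - (n \<bullet> \<xi>)\<^sup>2)" if \<xi>: "\<xi> \<in> great_circle \<omega>" for \<xi>
  proof -
    define \<mu> where "\<mu> = n \<bullet> \<xi>"
    have nz: "of_real \<gamma> + \<i> * of_real \<mu> \<noteq> (0 :: complex)"
      using \<gamma>0 by (auto simp: complex_eq_iff)
    have c0: "of_real (pi * (3 * \<gamma>\<^sup>2 - 1)) \<noteq> (0 :: complex)"
      using q0 by (subst of_real_eq_0_iff) auto
    have Tx: "T \<xi> = (of_real \<gamma> + \<i> * of_real \<mu>) ^ 3"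
      unfolding T_def J I[OF \<xi>] \<mu>_def[symmetric] using nz c0 K0 by (simp del: of_real_mult)
    have Re: "Re (T \<xi>) = \<gamma> ^ 3 - 3 * \<gamma> * \<mu>\<^sup>2" and Im: "Im (T \<xi>) = \<mu> * (3 * \<gamma>\<^sup>2 - \<mu>\<^sup>2)"
      unfolding Tx power3_eq_cube by (simp_all add: power2_eq_square algebra_simps)
    have "\<mu>\<^sup>2 \<le> 1"
    proof -
      have "\<bar>\<mu>\<bar> \<le> 1"
        using Cauchy_Schwarz_ineq2[of n \<xi>] n \<xi> by (simp add: \<mu>_def great_circle_def)
      then show ?thesis by (simp add: abs_square_le_1)
    qed
    then have "3 * \<gamma>\<^sup>2 - \<mu>\<^sup>2 \<noteq> 0" using q0 by linarith
    then show ?thesis using \<gamma>0 unfolding Re Im \<mu>_def[symmetric] by (simp add: field_simps)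
  qed
  ultimately show ?thesis
    unfolding Let_def I_def[symmetric] J_def[symmetric] M_def[symmetric] \<gamma>_def[symmetric] T_def
    by blast
qed

end
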